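(* Let $p$ be a prime and let $G$ be a just-infinite non-abelian pro-$p$ group which is virtually $\mathbb{Z}_p$. Then $\mathcal{S}(G)$ is homeomorphic to $P\oplus(\omega+1)$, where $P$ is Pełczyński space.
   Context: For a profinite group $G$, $\mathcal{S}(G)$ is the set of closed subgroups of $G$ with its natural profinite topology: a base of open neighbourhoods of $H\in\mathcal{S}(G)$ is given by the sets $B(H,N)=\{K \text{ closed subgroup of } G \mid KN=HN\}$, with $N$ ranging over the open normal subgroups of $G$. A profinite group is just-infinite if it is infinite and every non-trivial closed normal subgroup is open. "Virtually $\mathbb{Z}_p$" means having an open normal subgroup topologically isomorphic to the $p$-adic integers $\mathbb{Z}_p$. $\oplus$ denotes topological disjoint union, and the ordinal $\omega+1$ has the order topology (a convergent sequence with its limit). Pełczyński space $P$ is the subspace of $[0,1]$ consisting of the middle-third Cantor set together with the midpoints of all the open intervals deleted in its construction. *)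

theory Defs
  imports
    "HOL-Analysis.Analysis"
    "HOL-Algebra.Coset"
    "HOL-Computational_Algebra.Primes"
begin

section \<open>Profinite groups\<close>

locale topological_group = group G for G (structure) +
  fixes T :: "'a topology"
  assumes topspace_eq: "topspace T = carrier G"
    and continuous_mult: "continuous_map (prod_topology T T) T (\<lambda>(x, y). x \<otimes> y)"
    and continuous_inv: "continuous_map T T (\<lambda>x. inv x)"

definition totally_disconnected_space :: "'a topology \<Rightarrow> bool" where
  "totally_disconnected_space X \<longleftrightarrow>
     (\<forall>x \<in> topspace X. connected_component_of_set X x = {x})"

locale profinite_group = topological_group +
  assumes compact: "compact_space T"
    and Hausdorff: "Hausdorff_space T"
    and totally_disconnected: "totally_disconnected_space T"

text \<open>An infinite quotient would have order \<open>0\<close>, which is not a power of a prime.\<close>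

locale pro_p_group = profinite_group +
  fixes p :: nat
  assumes order_quotient: "N \<lhd> G \<Longrightarrow> openin T N \<Longrightarrow> \<exists>k. order (G Mod N) = p ^ k"

locale just_infinite_group = profinite_group +
  assumes infinite_carrier: "infinite (carrier G)"
    and open_normal: "N \<lhd> G \<Longrightarrow> closedin T N \<Longrightarrow> N \<noteq> {\<one>} \<Longrightarrow> openin T N"


section \<open>The $p$-adic integers\<close>

text \<open>The additive group of \<open>p\<close>-adic integers is the inverse limit of the groups of integers
  modulo \<open>p\<^sup>n\<close>, each represented by the residues \<open>0, \<dots>, p\<^sup>n - 1\<close> and carrying the discrete
  topology. It is written multiplicatively, as a group in the sense of HOL-Algebra.\<close>

definition padic_int_group :: "nat \<Rightarrow> (nat \<Rightarrow> int) monoid" where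
  "padic_int_group p =
     \<lparr>carrier = {x. \<forall>n. x n \<in> {0..<int p ^ n} \<and> x (Suc n) mod int p ^ n = x n},
      mult = (\<lambda>x y n. (x n + y n) mod int p ^ n),
      one = (\<lambda>n. 0)\<rparr>"

definition padic_int_topology :: "nat \<Rightarrow> (nat \<Rightarrow> int) topology" where
  "padic_int_topology p =
     subtopology (product_topology (\<lambda>n. discrete_topology {0..<int p ^ n}) UNIV)
       (carrier (padic_int_group p))"

lemma comm_group_padic_int_group:
  assumes "p > 0"
  shows "comm_group (padic_int_group p)"
proof (rule comm_groupI)
  have pos: "int p ^ n > 0" for n
    using assms by simp
  have proj: "(a mod int p ^ Suc n) mod int p ^ n = a mod int p ^ n" for a n
    by (simp add: mod_mod_cancel)
  fix x y z
  assume x: "x \<in> carrier (padic_int_group p)"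
  then have xn: "x n mod int p ^ n = x n" "x (Suc n) mod int p ^ n = x n" for n
    by (simp_all add: padic_int_group_def)
  show "\<one>\<^bsub>padic_int_group p\<^esub> \<otimes>\<^bsub>padic_int_group p\<^esub> x = x"
    by (simp add: padic_int_group_def xn)
  have "(\<lambda>n. - x n mod int p ^ n) \<in> carrier (padic_int_group p)"
    using pos by (simp add: padic_int_group_def proj del: power_Suc)
      (metis mod_minus_eq xn(2))
  then show "\<exists>y\<in>carrier (padic_int_group p).
      y \<otimes>\<^bsub>padic_int_group p\<^esub> x = \<one>\<^bsub>padic_int_group p\<^esub>"
    by (rule bexI[rotated]) (simp add: padic_int_group_def mod_simps)
  assume y: "y \<in> carrier (padic_int_group p)"
  then have yn: "y (Suc n) mod int p ^ n = y n" for n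
    by (simp add: padic_int_group_def)
  show "x \<otimes>\<^bsub>padic_int_group p\<^esub> y \<in> carrier (padic_int_group p)"
    using pos by (simp add: padic_int_group_def proj del: power_Suc)
      (metis mod_add_eq xn(2) yn)
  show "x \<otimes>\<^bsub>padic_int_group p\<^esub> y = y \<otimes>\<^bsub>padic_int_group p\<^esub> x"
    by (simp add: padic_int_group_def add.commute)
  show "(x \<otimes>\<^bsub>padic_int_group p\<^esub> y) \<otimes>\<^bsub>padic_int_group p\<^esub> z =
      x \<otimes>\<^bsub>padic_int_group p\<^esub> (y \<otimes>\<^bsub>padic_int_group p\<^esub> z)"
    by (simp add: padic_int_group_def mod_simps add.assoc)
next
  show "\<one>\<^bsub>padic_int_group p\<^esub> \<in> carrier (padic_int_group p)"
    using assms by (simp add: padic_int_group_def)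
qed

lemma topspace_padic_int_topology:
  "topspace (padic_int_topology p) = carrier (padic_int_group p)"
  by (auto simp: padic_int_topology_def padic_int_group_def PiE_def)

definition virtually_padic_int :: "nat \<Rightarrow> ('a, 'b) monoid_scheme \<Rightarrow> 'a topology \<Rightarrow> bool" where
  "virtually_padic_int p G T \<longleftrightarrow>
     (\<exists>N h. N \<lhd> G \<and> openin T N \<and>
        h \<in> iso (G\<lparr>carrier := N\<rparr>) (padic_int_group p) \<and>
        homeomorphic_map (subtopology T N) (padic_int_topology p) h)"


section \<open>The space of closed subgroups\<close>

definition closed_subgroups :: "('a, 'b) monoid_scheme \<Rightarrow> 'a topology \<Rightarrow> 'a set set" where
  "closed_subgroups G T = {H. subgroup H G \<and> closedin T H}"

definition subgroup_nbhd ::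
  "('a, 'b) monoid_scheme \<Rightarrow> 'a topology \<Rightarrow> 'a set \<Rightarrow> 'a set \<Rightarrow> 'a set set" where
  "subgroup_nbhd G T H N = {K \<in> closed_subgroups G T. K <#>\<^bsub>G\<^esub> N = H <#>\<^bsub>G\<^esub> N}"

definition subgroup_topology :: "('a, 'b) monoid_scheme \<Rightarrow> 'a topology \<Rightarrow> 'a set topology" where
  "subgroup_topology G T =
     topology_generated_by
       {subgroup_nbhd G T H N | H N. H \<in> closed_subgroups G T \<and> N \<lhd> G \<and> openin T N}"

text \<open>The generating sets form a base: those around \<open>H\<close> are a neighbourhood base at \<open>H\<close>.\<close>

lemma (in topological_group) openin_subgroup_topology:
  "openin (subgroup_topology G T) U \<longleftrightarrow>
     U \<subseteq> closed_subgroups G T \<and>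
     (\<forall>H\<in>U. \<exists>N. N \<lhd> G \<and> openin T N \<and> subgroup_nbhd G T H N \<subseteq> U)"
  (is "?L U \<longleftrightarrow> ?R U")
proof
  have sub: "\<And>H. H \<in> closed_subgroups G T \<Longrightarrow> H \<subseteq> carrier G"
    by (auto simp: closed_subgroups_def dest: subgroup.subset)
  have mono: "subgroup_nbhd G T H M \<subseteq> subgroup_nbhd G T H N"
    if H: "H \<in> closed_subgroups G T" and M: "M \<lhd> G" and N: "N \<lhd> G" and MN: "M \<subseteq> N" for H M N
  proof -
    have MsN: "M <#> N = N"
    proof
      show "M <#> N \<subseteq> N"
        using MN N by (auto simp: set_mult_def dest!: normal_imp_subgroup intro: subgroup.m_closed)
      have "\<one> \<in> M" using M by (auto dest!: normal_imp_subgroup intro: subgroup.one_closed)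
      moreover have "N \<subseteq> carrier G" using N normal_imp_subgroup subgroup.subset by blast
      ultimately show "N \<subseteq> M <#> N"
        by (force simp: set_mult_def)
    qed
    have c: "M \<subseteq> carrier G" "N \<subseteq> carrier G"
      using M N normal_imp_subgroup subgroup.subset by blast+
    have "(K <#> M) <#> N = K <#> N" if "K \<in> closed_subgroups G T" for K
      using set_mult_assoc[OF sub[OF that] c] MsN by simp
    then show ?thesis
      using H unfolding subgroup_nbhd_def by (smt (verit) mem_Collect_eq subsetI)
  qed
  show "?R U" if "?L U"
  proof -
    have "generate_topology_on
        {subgroup_nbhd G T H N | H N. H \<in> closed_subgroups G T \<and> N \<lhd> G \<and> openin T N} U"
      using that by (simp add: subgroup_topology_def openin_topology_generated_by_iff)
    then show ?thesis
    proof induction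
      case Empty
      then show ?case by simp
    next
      case (Int A B)
      show ?case
      proof (intro conjI ballI)
        show "A \<inter> B \<subseteq> closed_subgroups G T" using Int by blast
        fix H assume H: "H \<in> A \<inter> B"
        with Int obtain M N where
          M: "M \<lhd> G" "openin T M" "subgroup_nbhd G T H M \<subseteq> A" and
          N: "N \<lhd> G" "openin T N" "subgroup_nbhd G T H N \<subseteq> B" by blast
        have 1: "M \<inter> N \<lhd> G"
          using M(1) N(1)
          by (simp add: normal_inv_iff subgroups_Inter_pair)
        have H': "H \<in> closed_subgroups G T" using H Int by blast
        have "subgroup_nbhd G T H (M \<inter> N) \<subseteq> A \<inter> B"
          using mono[OF H' 1 M(1)] mono[OF H' 1 N(1)] M(3) N(3) by blast
        then show "\<exists>N. N \<lhd> G \<and> openin T N \<and> subgroup_nbhd G T H N \<subseteq> A \<inter> B"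
          using 1 M(2) N(2) by blast
      qed
    next
      case (UN K)
      then show ?case by (meson Sup_le_iff Union_iff Union_upper order_trans)
    next
      case (Basis S)
      then show ?case by (fastforce simp: subgroup_nbhd_def)
    qed
  qed
  show "?L U" if "?R U"
  proof (subst openin_subopen, intro ballI)
    fix H assume H: "H \<in> U"
    with that obtain N where N: "N \<lhd> G" "openin T N" "subgroup_nbhd G T H N \<subseteq> U" by blast
    have H': "H \<in> closed_subgroups G T" using that H by blast
    have "openin (subgroup_topology G T) (subgroup_nbhd G T H N)"
      unfolding subgroup_topology_def
      by (rule topology_generated_by_Basis) (use H' N in blast)
    moreover have "H \<in> subgroup_nbhd G T H N"
      using H' by (simp add: subgroup_nbhd_def)
    ultimately show "\<exists>V. openin (subgroup_topology G T) V \<and> H \<in> V \<and> V \<subseteq> U"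
      using N by blast
  qed
qed


section \<open>Topological disjoint union\<close>

text \<open>The binary version, for two possibly different types, of \<^const>\<open>sum_topology\<close>.\<close>

definition disjoint_union_topology :: "'a topology \<Rightarrow> 'b topology \<Rightarrow> ('a + 'b) topology"
    (infixr \<open>\<oplus>\<^sub>t\<^sub>o\<^sub>p\<close> 65) where
  "X \<oplus>\<^sub>t\<^sub>o\<^sub>p Y = topology (\<lambda>U. openin X (Inl -` U) \<and> openin Y (Inr -` U))"

lemma openin_disjoint_union_topology:
  "openin (X \<oplus>\<^sub>t\<^sub>o\<^sub>p Y) U \<longleftrightarrow> openin X (Inl -` U) \<and> openin Y (Inr -` U)"
proof -
  have "istopology (\<lambda>U. openin X (Inl -` U) \<and> openin Y (Inr -` U))"
    unfolding istopology_def by (auto simp: vimage_Union)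
  then show ?thesis
    by (simp add: disjoint_union_topology_def)
qed


section \<open>Pelczynski space\<close>

text \<open>The endpoints of the closed intervals left after \<open>n\<close> steps of the middle-third construction.
  The interval deleted from \<open>[a, b]\<close> in the following step has the same midpoint as \<open>[a, b]\<close>.\<close>

primrec cantor_intervals :: "nat \<Rightarrow> (real \<times> real) set" where
  "cantor_intervals 0 = {(0, 1)}"
| "cantor_intervals (Suc n) =
     (\<Union>(a, b)\<in>cantor_intervals n. {(a, a + (b - a) / 3), (b - (b - a) / 3, b)})"

definition cantor_set :: "real set" where
  "cantor_set = (\<Inter>n. \<Union>(a, b)\<in>cantor_intervals n. {a..b})"

definition pelczynski_set :: "real set" where
  "pelczynski_set = cantor_set \<union> (\<Union>n. \<Union>(a, b)\<in>cantor_intervals n. {(a + b) / 2})"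

abbreviation pelczynski_space :: "real topology" where
  "pelczynski_space \<equiv> top_of_set pelczynski_set"


section \<open>The ordinal $\omega + 1$\<close>

text \<open>As an ordered set, \<open>\<omega> + 1\<close> is \<^typ>\<open>enat\<close>, whose type class topology is the order topology.\<close>

abbreviation omega_plus_one :: "enat topology" where
  "omega_plus_one \<equiv> euclidean"

end

theory Submission
  imports Defs "HOL-Number_Theory.Number_Theory"
begin

text \<open>
  Let \<open>N \<cong> \<int>\<^sub>p\<close> be open and normal, and let \<open>C\<close> be its centralizer. The transfer \<open>C \<rightarrow> N\<close> has a
  finite kernel that is normal in \<open>G\<close>, hence trivial; so \<open>C\<close> is abelian and torsion-free, and
  \<open>C \<cong> \<int>\<^sub>p\<close>. An element of \<open>G\<close> acts on \<open>N\<close> by a \<open>p\<close>-adic unit whose order is a power of \<open>p\<close>, and the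
  only such units are \<open>1\<close> and, for \<open>p = 2\<close>, \<open>-1\<close>. As \<open>G\<close> is not abelian, \<open>p = 2\<close> and \<open>G\<close> is the
  pro-2 dihedral group \<open>C \<rtimes> \<langle>t\<rangle>\<close>. Its closed subgroups are those of \<open>C\<close>, which form a sequence
  converging to the trivial group, and for every \<open>n \<le> \<omega>\<close> the groups generated by \<open>2\<^sup>n\<int>\<^sub>2\<close> and a
  reflection \<open>a t\<close>, where only \<open>a\<close> modulo \<open>2\<^sup>n\<close> matters. The latter are the nodes (\<open>n < \<omega>\<close>) and the ends
  (\<open>n = \<omega>\<close>) of the binary tree, and so are the points of Pelczynski space: a node is the midpoint of
  an interval of the Cantor construction.\<close>

section \<open>Pelczynski space as a tree with its ends\<close>

text \<open>No map between points of [0,1] and subgroups is ever computed. Both spaces are images of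
  one set of codes, and one family of relations, equality of codes after truncation at level
  \<open>k\<close>, decides in each of them which codes give the same point and which sets are open.
  On the real side truncation is compared with distance; on the group side two closed subgroups
  agree at level \<open>k\<close> exactly if their products with 2^k C coincide. Being just-infinite
  enters through the absence of non-trivial finite normal subgroups: such a subgroup would be
  closed, hence open, and the group would be finite. The ring of p-adic integers is never built. An
  element is its sequence of residues modulo p^n, and dividing by p^s costs s levels, which is the
  source of the index shifts below. What holds in \<open>N\<close> is carried to its centralizer by
  the p^k-th power map, where p^k is the index of \<open>N\<close>; it sends the centralizer
  injectively into \<open>N\<close>.\<close>

lemma homeomorphic_space_common_parametrization:
  fixes E :: "nat \<Rightarrow> 'i \<Rightarrow> 'i \<Rightarrow> bool"
  assumes f: "range f = topspace X" and g: "range g = topspace Y"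
    and feq: "\<And>i j. f i = f j \<longleftrightarrow> (\<forall>k. E k i j)"
    and geq: "\<And>i j. g i = g j \<longleftrightarrow> (\<forall>k. E k i j)"
    and X: "\<And>U. U \<subseteq> topspace X \<Longrightarrow>
      openin X U \<longleftrightarrow> (\<forall>i. f i \<in> U \<longrightarrow> (\<exists>k. \<forall>j. E k i j \<longrightarrow> f j \<in> U))"
    and Y: "\<And>U. U \<subseteq> topspace Y \<Longrightarrow>
      openin Y U \<longleftrightarrow> (\<forall>i. g i \<in> U \<longrightarrow> (\<exists>k. \<forall>j. E k i j \<longrightarrow> g j \<in> U))"
  shows "X homeomorphic_space Y"
proof -
  \<comment> \<open>An arbitrary code of the point is chosen; as \<open>f\<close> and
    \<open>g\<close> identify the same codes, the choice does not matter.\<close>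
  define F where "F = g \<circ> inv_into UNIV f"
  have Ff: "F (f i) = g i" for i
    by (simp add: F_def geq flip: feq) (simp add: f_inv_into_f)
  have bij: "bij_betw F (topspace X) (topspace Y)"
    unfolding bij_betw_def
  proof
    show "inj_on F (topspace X)"
      by (auto simp: inj_on_def Ff feq geq simp flip: f)
    show "F ` topspace X = topspace Y"
      by (simp add: image_image Ff flip: f g)
  qed
  have iff: "openin Y (F ` U) \<longleftrightarrow> openin X U" if U: "U \<subseteq> topspace X" for U
  proof -
    have "g i \<in> F ` U \<longleftrightarrow> f i \<in> U" for i
    proof
      assume "g i \<in> F ` U"
      then obtain u where "u \<in> U" "g i = F u" by blast
      moreover obtain j where "u = f j" using \<open>u \<in> U\<close> U f by blast
      ultimately show "f i \<in> U" by (metis Ff feq geq)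
    qed (metis Ff imageI)
    moreover have "F ` U \<subseteq> topspace Y"
      using U bij by (auto simp: bij_betw_def)
    ultimately show ?thesis
      by (simp add: X[OF U] Y)
  qed
  have "openin X {x \<in> topspace X. F x \<in> U} \<longleftrightarrow> openin Y U" if "U \<subseteq> topspace Y" for U
  proof -
    have "U = F ` {x \<in> topspace X. F x \<in> U}"
      using that bij by (auto simp: bij_betw_def)
    then show ?thesis using iff[of "{x \<in> topspace X. F x \<in> U}"] by simp
  qed
  then have "homeomorphic_map X Y F"
    using bij by (simp add: bij_betw_def homeomorphic_map_def quotient_map_def)
  then show ?thesis
    by (rule homeomorphic_map_imp_homeomorphic_space)
qed

text \<open>Truncation at a level above a finite \<open>n\<close> isolates \<open>n\<close>, and the
  elements that truncate like \<infinity> form a tail: these are the basic neighbourhoods of the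
  order topology.\<close>

lemma open_enat_iff_min:
  fixes U :: "enat set"
  shows "open U \<longleftrightarrow> (\<forall>n\<in>U. \<exists>k. \<forall>m. min n (enat k) = min m (enat k) \<longrightarrow> m \<in> U)"
proof (intro iffI ballI)
  fix n assume U: "open U" and n: "n \<in> U"
  show "\<exists>k. \<forall>m. min n (enat k) = min m (enat k) \<longrightarrow> m \<in> U"
  proof (cases n)
    case (enat j)
    \<comment> \<open>Level \<open>j\<close> would be too coarse, since every m \<ge> j truncates to
      j there.\<close>
    then have "min n (enat (Suc j)) = min m (enat (Suc j)) \<Longrightarrow> m = n" for m
      by (cases m) (auto simp: min_def split: if_splits)
    then show ?thesis using n by blast
  next
    case infinity
    have "(0::enat) < \<infinity>" by simp
    with infinity open_left[OF U n] obtain b where b: "b < \<infinity>" "{b<..\<infinity>} \<subseteq> U" by metis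
    then obtain j where "b = enat j" by (cases b) auto
    then have "min n (enat (Suc j)) = min m (enat (Suc j)) \<Longrightarrow> m \<in> U" for m
      using b infinity by (cases m) (auto simp: min_def split: if_splits)
    then show ?thesis by blast
  qed
next
  assume *: "\<forall>n\<in>U. \<exists>k. \<forall>m. min n (enat k) = min m (enat k) \<longrightarrow> m \<in> U"
  show "open U"
  proof (subst open_subopen, intro ballI, goal_cases)
    case (1 n)
    show ?case
    proof (cases n)
      case (enat j)
      have "{n} = (if j = 0 then {..<enat 1} else {enat (j - 1)<..<enat (Suc j)})"
        unfolding enat
      proof (rule Set.set_eqI)
        fix m
        show "m \<in> {enat j} \<longleftrightarrow>
            m \<in> (if j = 0 then {..<enat 1} else {enat (j - 1)<..<enat (Suc j)})"
          by (cases m) auto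
      qed
      then have "open {n}" by simp
      then show ?thesis using 1 by blast
    next
      case infinity
      obtain k where k: "\<And>m. min n (enat k) = min m (enat k) \<Longrightarrow> m \<in> U"
        using * 1 by blast
      have "{enat k<..} \<subseteq> U"
        by (auto intro!: k simp: infinity)
      then show ?thesis
        using infinity by (intro exI[of _ "{enat k<..}"]) auto
    qed
  qed
qed

section \<open>Midpoints and ends of the Cantor construction\<close>

definition cantor_left :: "(nat \<Rightarrow> bool) \<Rightarrow> nat \<Rightarrow> real" where
  "cantor_left d n = (\<Sum>i<n. 2 * of_bool (d i) / 3 ^ Suc i)"

text \<open>\<open>cantor_left d n\<close> is the left end of the interval of length 3^-n reached by
  keeping the right third at step \<open>i\<close> exactly if \<open>d i\<close>. A node is sent to
  the midpoint of its interval, half a length further on, and an end to the Cantor point with the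
  corresponding ternary digits 0 and 2.\<close>

definition pelczynski_point :: "enat \<Rightarrow> (nat \<Rightarrow> bool) \<Rightarrow> real" where
  "pelczynski_point n d = (case n of
     enat n \<Rightarrow> cantor_left d n + 1 / (2 * 3 ^ n)
   | \<infinity> \<Rightarrow> (\<Sum>i. 2 * of_bool (d i) / 3 ^ Suc i))"

lemma cantor_left_cong:
  "(\<And>i. i < n \<Longrightarrow> d i = e i) \<Longrightarrow> cantor_left d n = cantor_left e n"
  by (simp add: cantor_left_def)

lemma cantor_left_Suc: "cantor_left d (Suc n) = cantor_left d n + 2 * of_bool (d n) * (1 / 3 ^ Suc n)"
  by (simp add: cantor_left_def)

lemma cantor_left_mono: "m \<le> n \<Longrightarrow> cantor_left d m \<le> cantor_left d n"
  by (rule lift_Suc_mono_le[of "cantor_left d"]) (auto simp: cantor_left_Suc)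

lemma cantor_right_antimono:
  "m \<le> n \<Longrightarrow> cantor_left d n + 1 / 3 ^ n \<le> cantor_left d m + 1 / 3 ^ m"
  by (rule lift_Suc_antimono_le[of "\<lambda>n. cantor_left d n + 1 / 3 ^ n"])
    (auto simp: cantor_left_Suc field_simps)

lemma cantor_intervals_eq:
  "cantor_intervals n = range (\<lambda>d. (cantor_left d n, cantor_left d n + 1 / 3 ^ n))"
proof (induction n)
  case 0
  then show ?case by (auto simp: cantor_left_def)
next
  case (Suc n)
  let ?I = "\<lambda>d n. (cantor_left d n, cantor_left d n + 1 / 3 ^ n)"
  have upd: "cantor_left (d(n := b)) n = cantor_left d n" for d b
    by (rule cantor_left_cong) auto
  have child: "(case ?I d n of (a, b) \<Rightarrow> {(a, a + (b - a) / 3), (b - (b - a) / 3, b)})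
      = {?I (d(n := False)) (Suc n), ?I (d(n := True)) (Suc n)}" for d
  proof -
    define r :: real where "r = 1 / 3 ^ Suc n"
    have "1 / 3 ^ n = 3 * r" by (simp add: r_def)
    then show ?thesis
      unfolding cantor_left_Suc upd r_def[symmetric] by (simp add: add_ac)
  qed
  \<comment> \<open>An interval of the next stage is a child of the interval with the same digits,
    so the range over all digit sequences contains nothing but children.\<close>
  have self: "?I d (Suc n) \<in> {?I (d(n := False)) (Suc n), ?I (d(n := True)) (Suc n)}" for d
    by (cases "d n") (auto simp: fun_upd_idem)
  have "cantor_intervals (Suc n) = (\<Union>d. {?I (d(n := False)) (Suc n), ?I (d(n := True)) (Suc n)})"
    unfolding cantor_intervals.simps Suc by (simp only: image_image child)
  also have "\<dots> = range (\<lambda>d. ?I d (Suc n))"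
    using self by blast
  finally show ?case .
qed

lemma cantor_series_summable: "summable (\<lambda>i. 2 * of_bool (d i) / 3 ^ Suc i :: real)"
proof (rule summable_comparison_test[OF exI[of _ 0]])
  show "summable (\<lambda>i. 2 * (1 / 3) ^ i :: real)"
    by (intro summable_mult summable_geometric) simp
qed (auto simp: field_simps)

text \<open>The intervals of a digit sequence are nested, which traps the midpoints of all stages
  from \<open>j\<close> on and, in the limit, the Cantor point.\<close>

lemma pelczynski_point_bounds:
  assumes "enat j \<le> n"
  shows "pelczynski_point n d \<in> {cantor_left d j .. cantor_left d j + 1 / 3 ^ j}"
proof (cases n)
  case (enat m)
  with assms have "j \<le> m" by simp
  define r :: real where "r = 1 / 3 ^ m"
  have "r \<ge> 0" "pelczynski_point n d = cantor_left d m + r / 2"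
    by (simp_all add: enat pelczynski_point_def r_def)
  then show ?thesis
    using cantor_left_mono[OF \<open>j \<le> m\<close>, of d] cantor_right_antimono[OF \<open>j \<le> m\<close>, of d]
    unfolding r_def[symmetric] by auto
next
  case infinity
  have "cantor_left d \<longlonglongrightarrow> pelczynski_point n d"
    using summable_LIMSEQ[OF cantor_series_summable[of d]] infinity
    by (simp add: pelczynski_point_def cantor_left_def[abs_def])
  moreover have "cantor_left d m \<le> cantor_left d j + 1 / 3 ^ j" if "m \<ge> j" for m
    using cantor_right_antimono[OF that, of d] by (smt (verit) divide_nonneg_nonneg zero_le_power)
  ultimately show ?thesis
    by (auto intro: LIMSEQ_le_const LIMSEQ_le_const2 cantor_left_mono)
qed

text \<open>A pair \<open>(n, d)\<close> stands for the node given by the first \<open>n\<close> digits of \<open>d\<close>, or for an end if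
  \<open>n = \<infinity>\<close>; the remaining digits of \<open>d\<close> are irrelevant. Two points are related at level \<open>k\<close> if
  they agree after truncation to the first \<open>k\<close> levels of the tree.\<close>

definition node_rel :: "nat \<Rightarrow> enat \<times> (nat \<Rightarrow> bool) \<Rightarrow> enat \<times> (nat \<Rightarrow> bool) \<Rightarrow> bool" where
  "node_rel k x y \<longleftrightarrow> min (fst x) (enat k) = min (fst y) (enat k) \<and>
     (\<forall>i. enat i < min (fst x) (enat k) \<longrightarrow> snd x i = snd y i)"

text \<open>The two thirds that are kept are separated by the deleted one, which has length 1 / 3 ^
  (k + 1).\<close>

lemma cantor_left_gap:
  assumes "cantor_left d k = cantor_left e k" "d k \<noteq> e k"
    and "x \<in> {cantor_left d (Suc k) .. cantor_left d (Suc k) + 1 / 3 ^ Suc k}"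
    and "y \<in> {cantor_left e (Suc k) .. cantor_left e (Suc k) + 1 / 3 ^ Suc k}"
  shows "\<bar>x - y\<bar> \<ge> 1 / 3 ^ Suc k"
proof -
  define r :: real where "r = 1 / 3 ^ Suc k"
  show ?thesis
    using assms unfolding cantor_left_Suc r_def[symmetric]
    by (cases "d k"; cases "e k") (auto simp: abs_if)
qed

text \<open>The two kept thirds of a stage-\<open>k\<close> interval are 1 / 3 ^ (k + 1) apart, but
  its midpoint is only half as far from either of them; this halved gap is the reason for the factor
  2 in the bound.\<close>

lemma node_rel_if_close:
  "\<bar>pelczynski_point n d - pelczynski_point m e\<bar> < 1 / (2 * 3 ^ k) \<Longrightarrow> node_rel k (n, d) (m, e)"
proof (induction k)
  case 0
  then show ?case by (auto simp: node_rel_def zero_enat_def[symmetric])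
next
  case (Suc k)
  have "1 / (2 * 3 ^ Suc k) \<le> (1 / (2 * 3 ^ k) :: real)" by (simp add: field_simps)
  with Suc have *: "node_rel k (n, d) (m, e)" by linarith
  \<comment> \<open>A node at level \<open>k\<close> is the centre of a deleted third, at least half
    its length away from every point that lies deeper below the same interval.\<close>
  have mid: False if n: "n = enat k" and m: "m > enat k" and l: "cantor_left d k = cantor_left e k"
    and c: "\<bar>pelczynski_point n d - pelczynski_point m e\<bar> < 1 / (2 * 3 ^ Suc k)" for n m d e
  proof -
    have "enat (Suc k) \<le> m" using m by (cases m) auto
    define r :: real where "r = 1 / 3 ^ Suc k"
    have "pelczynski_point n d = cantor_left e k + 3 / 2 * r" "1 / (2 * 3 ^ Suc k) = r / 2"
      by (simp_all add: n l pelczynski_point_def r_def)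
    with pelczynski_point_bounds[OF \<open>enat (Suc k) \<le> m\<close>, of e] c show False
      unfolding cantor_left_Suc r_def[symmetric]
      by (cases "e k") (auto simp: abs_less_iff)
  qed
  show ?case
  proof (cases "n < enat k \<or> m < enat k")
    case True
    with * have "n = m" "n < enat k" by (auto simp: node_rel_def min_def split: if_splits)
    with * show ?thesis
      by (cases m) (auto simp: node_rel_def min_def)
  next
    case False
    then have nm: "n \<ge> enat k" "m \<ge> enat k" by auto
    with * have de: "\<And>i. i < k \<Longrightarrow> d i = e i" by (auto simp: node_rel_def min_def)
    then have l: "cantor_left d k = cantor_left e k" by (rule cantor_left_cong)
    consider "n = enat k" "m = enat k" | "n = enat k" "m > enat k" | "m = enat k" "n > enat k"
      | "n > enat k" "m > enat k" using nm by fastforce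
    then show ?thesis
    proof cases
      case 1
      with de show ?thesis by (auto simp: node_rel_def min_def)
    next
      case 2
      then show ?thesis using mid[OF 2 l] Suc.prems by blast
    next
      case 3
      then show ?thesis using mid[OF 3 l[symmetric]] Suc.prems by (simp add: abs_minus_commute)
    next
      case 4
      then have nm: "enat (Suc k) \<le> n" "enat (Suc k) \<le> m" by (cases n; cases m; auto)+
      have "d k = e k"
      proof (rule ccontr)
        assume "d k \<noteq> e k"
        from cantor_left_gap[OF l this pelczynski_point_bounds[OF nm(1)] pelczynski_point_bounds[OF nm(2)]]
          Suc.prems
        have "1 / 3 ^ Suc k < (1 / (2 * 3 ^ Suc k) :: real)" by linarith
        then show False by (simp add: field_simps)
      qed
      with de have "\<And>i. i < Suc k \<Longrightarrow> d i = e i" by (auto simp: less_Suc_eq)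
      with nm show ?thesis by (auto simp: node_rel_def min_def)
    qed
  qed
qed

text \<open>Codes with equal truncations either name one and the same node of level less than
  \<open>k\<close>, or lie in a common interval of length 1 / 3 ^ k.\<close>

lemma close_if_node_rel:
  assumes "node_rel k (n, d) (m, e)"
  shows "\<bar>pelczynski_point n d - pelczynski_point m e\<bar> \<le> 1 / 3 ^ k"
proof (cases "n < enat k \<or> m < enat k")
  case True
  with assms have "n = m" "n < enat k" by (auto simp: node_rel_def min_def split: if_splits)
  moreover from this obtain j where "n = enat j" by (cases n) auto
  ultimately have "cantor_left d j = cantor_left e j"
    using assms by (intro cantor_left_cong) (auto simp: node_rel_def min_def)
  then show ?thesis
    unfolding \<open>n = m\<close>[symmetric] \<open>n = enat j\<close> by (simp add: pelczynski_point_def)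
next
  case False
  then have nm: "enat k \<le> n" "enat k \<le> m" by auto
  with assms have "cantor_left d k = cantor_left e k"
    by (intro cantor_left_cong) (auto simp: node_rel_def min_def)
  with pelczynski_point_bounds[OF nm(1), of d] pelczynski_point_bounds[OF nm(2), of e]
  show ?thesis by auto
qed

lemma cantor_set_eq: "cantor_set = range (pelczynski_point \<infinity>)"
proof (intro equalityI subsetI)
  fix x assume "x \<in> cantor_set"
  then have "\<exists>d. x \<in> {cantor_left d n .. cantor_left d n + 1 / 3 ^ n}" for n
    by (auto simp: cantor_set_def cantor_intervals_eq)
  then obtain D where D: "\<And>n. x \<in> {cantor_left (D n) n .. cantor_left (D n) n + 1 / 3 ^ n}"
    by metis
  \<comment> \<open>If the digits chosen at two stages differed first at \<open>i\<close>, then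
    \<open>x\<close> would lie in both children of one interval, against the gap between
    them.\<close>
  have agree: "D m i = D n i" if "i < n" "n \<le> m" for i m n
    using that
  proof (induction i rule: less_induct)
    case (less i)
    have l: "cantor_left (D m) i = cantor_left (D n) i"
      using less by (intro cantor_left_cong) auto
    have in_I: "x \<in> {cantor_left (D j) (Suc i) .. cantor_left (D j) (Suc i) + 1 / 3 ^ Suc i}"
      if "Suc i \<le> j" for j
      using D[of j] cantor_left_mono[OF that, of "D j"] cantor_right_antimono[OF that, of "D j"]
      by auto
    show ?case
    proof (rule ccontr)
      assume "D m i \<noteq> D n i"
      from cantor_left_gap[OF l this in_I in_I] less.prems have "1 / 3 ^ Suc i \<le> (0::real)" by simp
      moreover have "0 < (1 / 3 ^ Suc i :: real)" by simp
      ultimately show False by linarith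
    qed
  qed
  \<comment> \<open>The choice \<open>D n\<close> is constrained by \<open>x\<close> only in its
    first \<open>n\<close> digits, so digit \<open>i\<close> is read off from stage i + 1.\<close>
  define d where "d i = D (Suc i) i" for i
  have "cantor_left d n = cantor_left (D n) n" for n
    by (rule cantor_left_cong) (unfold d_def, rule agree[symmetric], auto)
  then have "\<bar>x - pelczynski_point \<infinity> d\<bar> \<le> 1 / 3 ^ n" for n
    using D[of n] pelczynski_point_bounds[of n \<infinity> d] by auto
  moreover have "(\<lambda>n. 1 / 3 ^ n :: real) \<longlonglongrightarrow> 0"
    by (simp add: LIMSEQ_inverse_realpow_zero divide_inverse)
  ultimately have "\<bar>x - pelczynski_point \<infinity> d\<bar> \<le> 0"
    by (meson LIMSEQ_le_const)
  then show "x \<in> range (pelczynski_point \<infinity>)" by auto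
next
  fix x assume "x \<in> range (pelczynski_point \<infinity>)"
  then show "x \<in> cantor_set"
    using pelczynski_point_bounds[of _ \<infinity>]
    by (fastforce simp: cantor_set_def cantor_intervals_eq)
qed

lemma pelczynski_set_eq: "pelczynski_set = range (\<lambda>x. pelczynski_point (fst x) (snd x))"
proof -
  have "(\<Union>(a, b)\<in>cantor_intervals n. {(a + b) / 2}) = range (pelczynski_point (enat n))" for n
  proof -
    have "(cantor_left d n + (cantor_left d n + 1 / 3 ^ n)) / 2 = pelczynski_point (enat n) d" for d
      by (simp add: pelczynski_point_def add_divide_distrib)
    then show ?thesis
      unfolding cantor_intervals_eq by (simp add: image_image UNION_singleton_eq_range)
  qed
  moreover have "range (\<lambda>x. pelczynski_point (fst x) (snd x)) = (\<Union>n. range (pelczynski_point n))"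
    by (auto simp: image_def)
  moreover have "(\<Union>n. A n) = A \<infinity> \<union> (\<Union>n. A (enat n))" for A :: "enat \<Rightarrow> real set"
  proof -
    have "A n \<subseteq> A \<infinity> \<union> (\<Union>n. A (enat n))" for n by (cases n) auto
    then show ?thesis by blast
  qed
  ultimately show ?thesis
    by (simp add: pelczynski_set_def cantor_set_eq)
qed

lemma small_inverse_power3: "\<epsilon> > 0 \<Longrightarrow> \<exists>k. 1 / 3 ^ k < (\<epsilon>::real)"
  using real_arch_pow_inv[of \<epsilon> "1/3"] by (auto simp: power_divide)

lemma pelczynski_point_eq_iff:
  "pelczynski_point n d = pelczynski_point m e \<longleftrightarrow> (\<forall>k. node_rel k (n, d) (m, e))"
proof
  assume "\<forall>k. node_rel k (n, d) (m, e)"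
  then have *: "\<bar>pelczynski_point n d - pelczynski_point m e\<bar> \<le> 1 / 3 ^ k" for k
    using close_if_node_rel by blast
  show "pelczynski_point n d = pelczynski_point m e"
  proof (rule ccontr)
    assume "\<not> ?thesis"
    then obtain k where "1 / 3 ^ k < \<bar>pelczynski_point n d - pelczynski_point m e\<bar>"
      using small_inverse_power3[of "\<bar>pelczynski_point n d - pelczynski_point m e\<bar>"] by auto
    with *[of k] show False by linarith
  qed
qed (simp add: node_rel_if_close)

text \<open>By the two estimates the class of a point under \<open>node_rel k\<close> lies between
  the balls of radii 1 / (2 * 3 ^ k) and 1 / 3 ^ k about it, so these classes and the metric balls
  define the same open sets.\<close>

lemma openin_pelczynski_space:
  assumes "U \<subseteq> pelczynski_set"
  shows "openin pelczynski_space U \<longleftrightarrow>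
    (\<forall>x. pelczynski_point (fst x) (snd x) \<in> U \<longrightarrow>
      (\<exists>k. \<forall>y. node_rel k x y \<longrightarrow> pelczynski_point (fst y) (snd y) \<in> U))"
    (is "_ \<longleftrightarrow> ?R")
proof
  assume U: "openin pelczynski_space U"
  show ?R
  proof (intro allI impI)
    fix x assume "pelczynski_point (fst x) (snd x) \<in> U"
    with U obtain \<epsilon> where \<epsilon>: "\<epsilon> > 0"
      "\<And>y. y \<in> pelczynski_set \<Longrightarrow> dist y (pelczynski_point (fst x) (snd x)) < \<epsilon> \<Longrightarrow> y \<in> U"
      by (metis openin_euclidean_subtopology_iff)
    then obtain k where k: "1 / 3 ^ k < \<epsilon>" using small_inverse_power3 by blast
    have "pelczynski_point (fst y) (snd y) \<in> U" if "node_rel k x y" for y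
      using close_if_node_rel[of k "fst x" "snd x" "fst y" "snd y"] that k
      by (intro \<epsilon>) (auto simp: pelczynski_set_eq dist_real_def)
    then show "\<exists>k. \<forall>y. node_rel k x y \<longrightarrow> pelczynski_point (fst y) (snd y) \<in> U" by blast
  qed
next
  assume R: ?R
  show "openin pelczynski_space U"
    unfolding openin_euclidean_subtopology_iff
  proof (intro conjI ballI assms)
    fix z assume "z \<in> U"
    then obtain x where x: "z = pelczynski_point (fst x) (snd x)"
      using assms pelczynski_set_eq by blast
    with R \<open>z \<in> U\<close> obtain k where
      k: "\<And>y. node_rel k x y \<Longrightarrow> pelczynski_point (fst y) (snd y) \<in> U" by blast
    show "\<exists>\<epsilon>>0. \<forall>w\<in>pelczynski_set. dist w z < \<epsilon> \<longrightarrow> w \<in> U"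
    proof (intro exI conjI ballI impI)
      show "0 < 1 / (2 * 3 ^ k :: real)" by simp
      fix w assume "w \<in> pelczynski_set" and d: "dist w z < 1 / (2 * 3 ^ k)"
      then obtain y where y: "w = pelczynski_point (fst y) (snd y)"
        using pelczynski_set_eq by blast
      have "node_rel k x y"
        using d node_rel_if_close[of "fst x" "snd x" "fst y" "snd y" k]
        by (simp add: x y dist_real_def abs_minus_commute)
      with k y show "w \<in> U" by simp
    qed
  qed
qed

section \<open>Codes for the points of the disjoint union\<close>

type_synonym subgroup_code = "(enat \<times> (nat \<Rightarrow> bool)) + enat"

text \<open>The left summand codes the tree with its ends, later the dihedral subgroups; the right
  summand codes the ordinal, later the subgroups of \<open>C\<close>. Codes of different summands
  are never related, which makes both parts open.\<close>

definition code_rel :: "nat \<Rightarrow> subgroup_code \<Rightarrow> subgroup_code \<Rightarrow> bool" where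
  "code_rel k i j = (case (i, j) of
     (Inl x, Inl y) \<Rightarrow> node_rel k x y
   | (Inr n, Inr m) \<Rightarrow> min n (enat k) = min m (enat k)
   | _ \<Rightarrow> False)"

lemma code_rel_simps [simp]:
  "code_rel k (Inl x) (Inl y) \<longleftrightarrow> node_rel k x y"
  "code_rel k (Inr n) (Inr m) \<longleftrightarrow> min n (enat k) = min m (enat k)"
  "\<not> code_rel k (Inl x) (Inr m)" "\<not> code_rel k (Inr n) (Inl y)"
  by (simp_all add: code_rel_def)

lemma enat_eq_iff_min: "n = m \<longleftrightarrow> (\<forall>k. min n (enat k) = min m (enat k))"
proof
  assume *: "\<forall>k. min n (enat k) = min m (enat k)"
  have less: False if "min n (enat (Suc j)) = min m (enat (Suc j))" "n = enat j" "n < m" for n m j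
    using that by (cases m) (auto simp: min_def split: if_splits)
  show "n = m"
  proof (rule ccontr)
    assume "n \<noteq> m"
    then consider "n < m" | "m < n" by (rule linorder_neqE)
    then show False
    proof cases
      case 1
      then obtain j where "n = enat j" by (cases n) auto
      with less[OF _ this 1] * show False by blast
    next
      case 2
      then obtain j where "m = enat j" by (cases m) auto
      with less[OF _ this 2] * show False by metis
    qed
  qed
qed simp

lemma all_sum_type: "(\<forall>x. P x) \<longleftrightarrow> (\<forall>a. P (Inl a)) \<and> (\<forall>b. P (Inr b))"
  by (metis sumE)

text \<open>With the known space already described by truncated codes, only such a description of
  \<open>Y\<close> is left to be supplied.\<close>

theorem homeomorphic_space_pelczynski_omega:
  fixes g :: "subgroup_code \<Rightarrow> 'a"
  assumes g: "range g = topspace Y"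
    and geq: "\<And>i j. g i = g j \<longleftrightarrow> (\<forall>k. code_rel k i j)"
    and Y: "\<And>U. U \<subseteq> topspace Y \<Longrightarrow>
      openin Y U \<longleftrightarrow> (\<forall>i. g i \<in> U \<longrightarrow> (\<exists>k. \<forall>j. code_rel k i j \<longrightarrow> g j \<in> U))"
  shows "Y homeomorphic_space (pelczynski_space \<oplus>\<^sub>t\<^sub>o\<^sub>p omega_plus_one)"
proof -
  let ?X = "pelczynski_space \<oplus>\<^sub>t\<^sub>o\<^sub>p omega_plus_one"
  let ?f = "map_sum (\<lambda>x. pelczynski_point (fst x) (snd x)) (id :: enat \<Rightarrow> enat)"
  \<comment> \<open>The disjoint union is given by its open sets alone, so its underlying set is
    found as the largest of them.\<close>
  have top: "topspace ?X = Inl ` pelczynski_set \<union> range Inr"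
  proof -
    have "openin ?X (Inl ` pelczynski_set \<union> range Inr)"
      by (simp add: openin_disjoint_union_topology vimage_Un inj_vimage_image_eq vimage_image_eq
          flip: topspace_euclidean_subtopology)
        (simp add: vimage_def image_def)
    moreover have "U \<subseteq> Inl ` pelczynski_set \<union> range Inr" if "openin ?X U" for U
    proof
      fix z assume "z \<in> U"
      have "Inl -` U \<subseteq> pelczynski_set"
        using that openin_imp_subset[of euclidean pelczynski_set "Inl -` U"]
        by (simp add: openin_disjoint_union_topology)
      with \<open>z \<in> U\<close> show "z \<in> Inl ` pelczynski_set \<union> range Inr"
        by (cases z) auto
    qed
    ultimately show ?thesis
      by (meson openin_subset openin_topspace subset_antisym)
  qed
  show ?thesis
  proof (subst homeomorphic_space_sym, rule homeomorphic_space_common_parametrization)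
    show "range ?f = topspace ?X"
      unfolding top unfolding pelczynski_set_eq UNIV_sum image_Un by (simp add: image_image)
    show "?f i = ?f j \<longleftrightarrow> (\<forall>k. code_rel k i j)" for i j
      by (cases i; cases j) (auto simp: pelczynski_point_eq_iff enat_eq_iff_min[symmetric])
    show "openin ?X U \<longleftrightarrow> (\<forall>i. ?f i \<in> U \<longrightarrow> (\<exists>k. \<forall>j. code_rel k i j \<longrightarrow> ?f j \<in> U))"
      if "U \<subseteq> topspace ?X" for U
    proof -
      have "Inl -` U \<subseteq> pelczynski_set" using that top by auto
      from openin_pelczynski_space[OF this]
      have X: "openin pelczynski_space (Inl -` U) \<longleftrightarrow>
          (\<forall>x. ?f (Inl x) \<in> U \<longrightarrow> (\<exists>k. \<forall>y. node_rel k x y \<longrightarrow> ?f (Inl y) \<in> U))"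
        by (simp only: map_sum.simps vimage_eq)
      have Y: "open (Inr -` U :: enat set) \<longleftrightarrow>
          (\<forall>n. ?f (Inr n) \<in> U \<longrightarrow> (\<exists>k. \<forall>m. min n (enat k) = min m (enat k) \<longrightarrow> ?f (Inr m) \<in> U))"
        by (simp only: open_enat_iff_min Ball_def map_sum.simps vimage_eq id_apply)
      show ?thesis
        unfolding openin_disjoint_union_topology open_openin[symmetric] X Y
          all_sum_type[where P = "\<lambda>i. ?f i \<in> U \<longrightarrow> _ i"]
          all_sum_type[where P = "\<lambda>j. code_rel _ _ j \<longrightarrow> _ j"]
        by (simp only: simp_thms code_rel_simps)
    qed
  qed (use assms in auto)
qed

section \<open>$p$-adic integers\<close>

lemma padic_int_mod:
  assumes "x \<in> carrier (padic_int_group p)" "m \<le> n"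
  shows "x n mod int p ^ m = x m"
  using assms(2)
proof (induction n rule: dec_induct)
  case base
  then show ?case using assms(1) by (simp add: padic_int_group_def)
next
  case (step n)
  have "x (Suc n) mod int p ^ m = x (Suc n) mod int p ^ n mod int p ^ m"
    using step.hyps by (simp add: mod_mod_cancel le_imp_power_dvd)
  also have "\<dots> = x m"
    using assms(1) step.IH by (simp add: padic_int_group_def)
  finally show ?case .
qed

lemma padic_int_bounds:
  "x \<in> carrier (padic_int_group p) \<Longrightarrow> 0 \<le> x n"
  "x \<in> carrier (padic_int_group p) \<Longrightarrow> x n < int p ^ n"
  by (auto simp: padic_int_group_def)

text \<open>This is division by p^s of a p-adic integer whose residue modulo p^s vanishes. The
  quotient modulo p^n depends on \<open>x\<close> modulo p^(s+n), hence the shifted index.\<close>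

lemma padic_int_shift:
  assumes x: "x \<in> carrier (padic_int_group p)" and s: "x s = 0" and p: "p > 0"
  shows "int p ^ s * (x (s + n) div int p ^ s) = x (s + n)"
    and "(\<lambda>n. x (s + n) div int p ^ s) \<in> carrier (padic_int_group p)"
proof -
  have eq: "int p ^ s * (x (s + n) div int p ^ s) = x (s + n)" for n
    using padic_int_mod[OF x, of s "s + n"] s by (simp add: dvd_eq_mod_eq_0)
  then show "int p ^ s * (x (s + n) div int p ^ s) = x (s + n)" .
  have pos: "int p ^ n > 0" for n using p by simp
  have "x (s + n) div int p ^ s < int p ^ n" for n
  proof -
    have "int p ^ s * (x (s + n) div int p ^ s) < int p ^ s * int p ^ n"
      using padic_int_bounds(2)[OF x, of "s + n"] by (simp add: eq power_add)
    then show ?thesis using pos[of s] by simp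
  qed
  moreover have "0 \<le> x (s + n) div int p ^ s" for n
    using padic_int_bounds(1)[OF x] pos by (simp add: pos_imp_zdiv_nonneg_iff)
  moreover have "x (s + Suc n) div int p ^ s mod int p ^ n = x (s + n) div int p ^ s" for n
  proof -
    have "int p ^ s * (x (s + Suc n) div int p ^ s mod int p ^ n) = x (s + Suc n) mod int p ^ (s + n)"
      unfolding mult_mod_right eq power_add ..
    also have "\<dots> = int p ^ s * (x (s + n) div int p ^ s)"
      unfolding eq by (rule padic_int_mod[OF x]) simp
    finally show ?thesis using p by simp
  qed
  ultimately show "(\<lambda>n. x (s + n) div int p ^ s) \<in> carrier (padic_int_group p)"
    by (auto simp: padic_int_group_def)
qed

text \<open>Here \<open>a\<close> has valuation exactly \<open>n\<close> and \<open>c\<close> at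
  least \<open>n\<close>. With a = p^n u and c = p^n w the factor u is invertible modulo p^m, and i
  = w / u works. It serves to approximate everything of valuation at least \<open>n\<close> by
  powers of a single element.\<close>

lemma exists_multiple_mod_prime_power:
  fixes a c :: int
  assumes p: "prime p" and a: "a mod int p ^ n = 0" "a mod int p ^ Suc n \<noteq> 0"
    and c: "c mod int p ^ n = 0"
  shows "\<exists>i::nat. int i * a mod int p ^ m = c mod int p ^ m"
proof -
  obtain u w where u: "a = int p ^ n * u" and w: "c = int p ^ n * w"
    using a(1) c by (metis dvd_def mod_0_imp_dvd)
  have "\<not> int p dvd u" using a(2) u by (auto simp: mult.commute)
  then have "coprime u (int p ^ m)"
    using p prime_imp_coprime[of "int p" u] by (simp add: coprime_commute)
  then obtain x where x: "[u * x = 1] (mod int p ^ m)"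
    using cong_solve_coprime_int by blast
  have "int p ^ m > 0" using p by (simp add: prime_gt_0_nat)
  define i where "i = nat (x * w mod int p ^ m)"
  have "[int i * a = x * w * a] (mod int p ^ m)"
    using \<open>int p ^ m > 0\<close> by (simp add: i_def cong_def mod_mult_left_eq)
  also have "x * w * a = (u * x) * c" by (simp add: u w)
  also have "[(u * x) * c = 1 * c] (mod int p ^ m)" by (rule cong_mult[OF x cong_refl])
  finally show ?thesis by (auto simp: cong_def)
qed

text \<open>Only the algebraic isomorphism is recorded: \<open>h x n\<close> is the residue of
  \<open>x\<close> modulo p^n, and all arithmetic is done on these integers. The locale serves for
  the open subgroup and again for its centralizer.\<close>

locale padic_subgroup = group G for G (structure) +
  fixes N :: "'a set" and h :: "'a \<Rightarrow> nat \<Rightarrow> int" and p :: nat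
  assumes subgroup: "subgroup N G"
    and iso: "h \<in> iso (G\<lparr>carrier := N\<rparr>) (padic_int_group p)"
    and prime: "prime p"
begin

lemma mem_carrier: "x \<in> N \<Longrightarrow> x \<in> carrier G"
  using subgroup subgroup.mem_carrier by metis

lemma closed: "\<one> \<in> N" "x \<in> N \<Longrightarrow> inv x \<in> N" "x \<in> N \<Longrightarrow> y \<in> N \<Longrightarrow> x \<otimes> y \<in> N"
  using subgroup by (auto intro: subgroup.one_closed subgroup.m_inv_closed subgroup.m_closed)

lemma pow_closed: "x \<in> N \<Longrightarrow> x [^] (i::nat) \<in> N"
  by (induction i) (auto simp: closed)

lemma power_pos: "int p ^ n > 0"
  using prime by (simp add: prime_gt_0_nat)

lemma coord_padic: "x \<in> N \<Longrightarrow> h x \<in> carrier (padic_int_group p)"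
  using iso by (auto simp: iso_def bij_betw_def)

lemma coord_bounds: "x \<in> N \<Longrightarrow> 0 \<le> h x n" "x \<in> N \<Longrightarrow> h x n < int p ^ n"
  using padic_int_bounds[OF coord_padic] by auto

lemma coord_mod: "x \<in> N \<Longrightarrow> m \<le> n \<Longrightarrow> h x n mod int p ^ m = h x m"
  using padic_int_mod[OF coord_padic] .

lemma coord_mult: "x \<in> N \<Longrightarrow> y \<in> N \<Longrightarrow> h (x \<otimes> y) n = (h x n + h y n) mod int p ^ n"
  using iso by (auto simp: iso_def hom_def padic_int_group_def)

lemma coord_one: "h \<one> n = 0"
proof -
  have "(h \<one> n + h \<one> n) mod int p ^ n = (h \<one> n + 0) mod int p ^ n"
    using coord_mult[OF closed(1) closed(1), of n] coord_mod[OF closed(1), of n n] by simp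
  then have "h \<one> n mod int p ^ n = 0 mod int p ^ n"
    by (metis (no_types) cong_add_lcancel cong_def)
  with coord_mod[OF closed(1), of n n] show ?thesis by simp
qed

lemma coord_inv:
  assumes "x \<in> N"
  shows "h (inv x) n = - h x n mod int p ^ n"
proof -
  have "(h (inv x) n + h x n) mod int p ^ n = 0"
    using coord_mult[OF closed(2)[OF assms] assms, of n] assms by (simp add: mem_carrier coord_one)
  then have "(h (inv x) n + h x n - h x n) mod int p ^ n = (0 - h x n) mod int p ^ n"
    by (metis (no_types) mod_diff_left_eq mod_0)
  then show ?thesis
    using coord_mod[OF closed(2)[OF assms], of n n] by simp
qed

lemma coord_eqI: "x \<in> N \<Longrightarrow> y \<in> N \<Longrightarrow> (\<And>n. h x n = h y n) \<Longrightarrow> x = y"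
  using iso by (simp add: iso_def bij_betw_def) (metis ext inj_onD)

lemma coord_surj:
  assumes "z \<in> carrier (padic_int_group p)"
  obtains x where "x \<in> N" "h x = z"
proof -
  have "z \<in> h ` N" using iso assms by (auto simp: iso_def bij_betw_def)
  then show ?thesis using that by auto
qed

lemma coord_pow: "x \<in> N \<Longrightarrow> h (x [^] (i::nat)) n = int i * h x n mod int p ^ n"
  by (induction i) (auto simp: pow_closed coord_one coord_mult algebra_simps mod_simps)

lemma commutes: "x \<in> N \<Longrightarrow> y \<in> N \<Longrightarrow> x \<otimes> y = y \<otimes> x"
  by (rule coord_eqI) (auto simp: closed coord_mult add.commute)

text \<open>Write i = p^a b with b prime to p. The factor b can be cancelled modulo any power of p,
  while p^a costs a levels; hence level \<open>n\<close> is read off from level a + n.\<close>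

lemma torsion_free:
  assumes x: "x \<in> N" and "x [^] (i::nat) = \<one>" and i: "i > 0"
  shows "x = \<one>"
proof (rule coord_eqI[OF x closed(1)])
  fix n
  obtain b where b: "i = p ^ multiplicity p i * b" "\<not> p dvd b"
    using multiplicity_decompose'[of i p] i prime by (metis not_prime_unit neq0_conv)
  define a where "a = multiplicity p i"
  have "int p ^ (a + n) dvd int i * h x (a + n)"
    using coord_pow[OF x, of i "a + n"] assms(2) by (simp add: coord_one dvd_eq_mod_eq_0)
  then have "int p ^ a * int p ^ n dvd int p ^ a * (int b * h x (a + n))"
    using b(1) by (metis a_def mult.assoc of_nat_mult of_nat_power power_add)
  then have "int p ^ n dvd int b * h x (a + n)"
    using prime_gt_0_nat[OF prime] by simp
  moreover have "coprime (int p ^ n) (int b)"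
    using b(2) prime by (simp add: prime_imp_coprime)
  ultimately have "int p ^ n dvd h x (a + n)"
    by (simp add: coprime_dvd_mult_right_iff)
  then show "h x n = h \<one> n"
    using coord_mod[OF x, of n "a + n"] by (simp add: coord_one dvd_eq_mod_eq_0)
qed

text \<open>The shifted quotient sequence is \<open>x\<close> divided by p^n in additive notation,
  and surjectivity of \<open>h\<close> supplies the element with these coordinates.\<close>

lemma exists_root:
  assumes x: "x \<in> N" and "h x n = 0"
  obtains y where "y \<in> N" "y [^] (p ^ n) = x"
proof -
  let ?z = "\<lambda>m. h x (n + m) div int p ^ n"
  have p: "p > 0" using prime prime_gt_0_nat by blast
  obtain y where y: "y \<in> N" "h y = ?z"
    using coord_surj[OF padic_int_shift(2)[OF coord_padic[OF x] assms(2) p]] .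
  have "y [^] (p ^ n) = x"
  proof (rule coord_eqI)
    fix m
    have "h (y [^] (p ^ n)) m = int p ^ n * ?z m mod int p ^ m"
      by (simp add: coord_pow y)
    also have "\<dots> = h x m"
      unfolding padic_int_shift(1)[OF coord_padic[OF x] assms(2) p]
      by (rule coord_mod[OF x]) simp
    finally show "h (y [^] (p ^ n)) m = h x m" .
  qed (use x y pow_closed in auto)
  with y(1) show ?thesis by (rule that)
qed

end

section \<open>Roots of unity of p-power order\<close>

text \<open>The sum is the cofactor of a - 1 in a^p - 1. For odd p, putting a = 1 + p b gives p + p
  b p (p - 1) / 2 modulo p^2, which is p. For p = 2 it is 1 + a, twice an odd number by the
  assumption modulo 4.\<close>

lemma sum_powers_prime_part:
  fixes a :: int
  assumes p: "prime p" and a: "int p dvd a - 1" "p = 2 \<Longrightarrow> 4 dvd a - 1"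
  obtains w where "(\<Sum>i<p. a ^ i) = int p * w" "coprime (int p) w"
proof (cases "p = 2")
  case True
  with a obtain b where "a - 1 = 4 * b" by (auto simp: dvd_def)
  then have "(\<Sum>i<p. a ^ i) = int p * (1 + 2 * b)"
    using True by (simp add: numeral_2_eq_2)
  moreover have "coprime (int p) (1 + 2 * b)" using True by simp
  ultimately show ?thesis by (rule that)
next
  case False
  then have "odd p" using p prime_odd_nat prime_ge_2_nat[OF p] by force
  obtain b where b: "a = 1 + int p * b" using a(1) by (auto simp: dvd_def algebra_simps)
  have pow: "[a ^ i = 1 + int i * (int p * b)] (mod int p ^ 2)" for i
  proof (induction i)
    case (Suc i)
    have "[a * a ^ i = a * (1 + int i * (int p * b))] (mod int p ^ 2)"
      by (rule cong_mult[OF cong_refl Suc])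
    also have "a * (1 + int i * (int p * b)) =
        1 + int (Suc i) * (int p * b) + int p ^ 2 * (int i * b ^ 2)"
      by (simp add: b algebra_simps power2_eq_square)
    also have "[\<dots> = 1 + int (Suc i) * (int p * b)] (mod int p ^ 2)"
      by (simp add: cong_def)
    finally show ?case by simp
  qed simp
  \<comment> \<open>The sum of the exponents is divisible by p because p is odd, so the linear term
    vanishes modulo p^2.\<close>
  have "int (\<Sum>i<p. i) = int p * int ((p - 1) div 2)"
  proof -
    have "2 * (\<Sum>i<p. i) = p * (p - 1)"
      using gauss_sum_nat[of "p - 1"] p prime_gt_0_nat[OF p]
      by (simp add: lessThan_Suc_atMost[symmetric] atLeast0AtMost mult.commute)
    moreover have "p - 1 = 2 * ((p - 1) div 2)" using \<open>odd p\<close> by simp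
    ultimately have "2 * (\<Sum>i<p. i) = 2 * (p * ((p - 1) div 2))"
      by (metis mult.left_commute)
    then show ?thesis by (simp flip: of_nat_mult del: of_nat_sum)
  qed
  moreover have "(\<Sum>i<p. 1 + int i * (int p * b)) = int p + int (\<Sum>i<p. i) * (int p * b)"
    by (simp add: sum.distrib sum_distrib_right)
  ultimately have "(\<Sum>i<p. 1 + int i * (int p * b)) = int p + int p ^ 2 * (b * int ((p - 1) div 2))"
    by (simp only: power2_eq_square mult_ac)
  moreover have "[(\<Sum>i<p. a ^ i) = (\<Sum>i<p. 1 + int i * (int p * b))] (mod int p ^ 2)"
    by (rule cong_sum) (rule pow)
  ultimately have "[(\<Sum>i<p. a ^ i) = int p] (mod int p ^ 2)"
    by (simp add: cong_def)
  then obtain z where "(\<Sum>i<p. a ^ i) - int p = int p ^ 2 * z"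
    by (auto simp: cong_iff_dvd_diff dvd_def)
  then have "(\<Sum>i<p. a ^ i) = int p * (1 + int p * z)"
    by (simp add: algebra_simps power2_eq_square)
  moreover have "coprime (int p) (1 + int p * z)"
    by (metis coprime_1_right gcd_add_mult coprime_iff_gcd_eq_1 add.commute mult.commute)
  ultimately show ?thesis by (rule that)
qed

text \<open>Each p-th power adds exactly one factor p to a - 1. The induction passes from
  \<open>a\<close> to a^p, which inherits the congruences because a - 1 divides a^p - 1.\<close>

lemma lifting_the_exponent_converse:
  fixes a :: int
  assumes "prime p" "int p dvd a - 1" "p = 2 \<Longrightarrow> 4 dvd a - 1"
    and "int p ^ (n + k) dvd a ^ (p ^ k) - 1"
  shows "int p ^ n dvd a - 1"
  using assms(2-4)
proof (induction k arbitrary: a n)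
  case (Suc k)
  have "a - 1 dvd a ^ p - 1"
    unfolding power_diff_1_eq[of a p] by (rule dvd_triv_left)
  have "int p ^ Suc n dvd a ^ p - 1"
  proof (rule Suc.IH)
    show "int p dvd a ^ p - 1" "p = 2 \<Longrightarrow> 4 dvd a ^ p - 1"
      using Suc.prems(1,2) \<open>a - 1 dvd a ^ p - 1\<close> by (blast intro: dvd_trans)+
    show "int p ^ (Suc n + k) dvd (a ^ p) ^ p ^ k - 1"
      using Suc.prems(3) by (simp only: power_mult[symmetric] power_Suc add_Suc add_Suc_right)
  qed
  moreover obtain w where w: "(\<Sum>i<p. a ^ i) = int p * w" "coprime (int p) w"
    using sum_powers_prime_part[OF assms(1) Suc.prems(1,2)] by blast
  moreover have "a ^ p - 1 = (a - 1) * (\<Sum>i<p. a ^ i)"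
    by (rule power_diff_1_eq)
  ultimately have "int p * int p ^ n dvd int p * ((a - 1) * w)"
    by (simp add: algebra_simps)
  then have "int p ^ n dvd (a - 1) * w"
    using prime_gt_0_nat[OF assms(1)] by simp
  with w(2) show ?case
    by (simp add: coprime_dvd_mult_left_iff)
qed simp

lemma int_fermat_power:
  fixes a :: int
  assumes p: "prime p"
  shows "[a ^ (p ^ k) = a] (mod int p)"
proof (induction k)
  case (Suc k)
  have fermat: "[b ^ p = b] (mod int p)" for b :: int
  proof (cases "int p dvd b")
    case True
    moreover have "int p dvd b ^ p" using True p by (meson dvd_power dvd_trans prime_gt_0_nat)
    ultimately show ?thesis by (simp add: cong_def)
  next
    case False
    define c where "c = nat (b mod int p)"
    have c: "[int c = b] (mod int p)"
      using p prime_gt_0_nat by (simp add: c_def cong_def)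
    then have "\<not> p dvd c" using False by (metis cong_dvd_iff int_dvd_int_iff cong_sym)
    then have "[c ^ (p - 1) = 1] (mod p)" using p by (rule fermat_theorem[rotated])
    then have "[int c ^ (p - 1) * int c = 1 * int c] (mod int p)"
      by (intro cong_mult cong_refl) (metis cong_int_iff of_nat_1 of_nat_power)
    moreover have "int c ^ (p - 1) * int c = int c ^ p"
      using prime_gt_0_nat[OF p] by (simp flip: power_Suc2)
    ultimately have "[int c ^ p = int c] (mod int p)" by simp
    then show ?thesis
      using c cong_pow[OF c, of p] by (meson cong_sym cong_trans)
  qed
  have "a ^ (p ^ Suc k) = (a ^ (p ^ k)) ^ p" by (simp add: power_mult[symmetric] mult.commute)
  then show ?case using fermat[of "a ^ (p ^ k)"] Suc cong_trans by metis
qed simp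

text \<open>By Fermat such a root of unity is 1 modulo p, so for odd p the exponent lemma forces it
  to be 1 to every precision. For p = 2 it may be 1 or -1 modulo 4; multiplication by a sign
  \<open>s\<close> brings it to 1 modulo 4, and it equals that sign.\<close>

lemma padic_prime_power_root_of_unity:
  fixes z :: "nat \<Rightarrow> int"
  assumes p: "prime p" and z: "\<And>m n. m \<le> n \<Longrightarrow> [z n = z m] (mod int p ^ m)"
    and root: "\<And>n. [z n ^ (p ^ k) = 1] (mod int p ^ n)"
  shows "(\<forall>n. [z n = 1] (mod int p ^ n)) \<or> p = 2 \<and> (\<forall>n. [z n = - 1] (mod int p ^ n))"
proof -
  \<comment> \<open>The sign \<open>s\<close> will be 1 or -1. The exponent is raised to
    \<open>Suc k\<close> because for k = 0 the power p^k = 1 would not remove the sign.\<close>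
  have lift: "[s * z n = 1] (mod int p ^ n)"
    if s: "s ^ (p ^ Suc k) = 1" "p = 2 \<Longrightarrow> 4 dvd s * z 2 - 1" "int p dvd s * z 1 - 1" for s n
  proof -
    \<comment> \<open>Lifting loses \<open>Suc k\<close> levels; the further 1 guarantees m \<ge> 2,
      so that \<open>z m\<close> can be compared with \<open>z 2\<close> modulo 4.\<close>
    define m where "m = n + Suc k + 1"
    have "[z m = z 1] (mod int p)" using z[of 1 m] by (simp add: m_def)
    then have "[s * z m - 1 = s * z 1 - 1] (mod int p)" by (intro cong_diff cong_mult cong_refl)
    then have 1: "int p dvd s * z m - 1" using s(3) cong_dvd_iff by blast
    have 2: "4 dvd s * z m - 1" if "p = 2"
    proof -
      have "[z m = z 2] (mod 4)" using z[of 2 m] that by (simp add: m_def)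
      then have "[s * z m - 1 = s * z 2 - 1] (mod 4)" by (intro cong_diff cong_mult cong_refl)
      then show ?thesis using s(2)[OF that] cong_dvd_iff by blast
    qed
    have "[(s * z m) ^ (p ^ Suc k) = 1 * 1 ^ p] (mod int p ^ m)"
      using cong_pow[OF root[of m], of p] s(1)
      by (simp add: power_mult_distrib power_mult[symmetric] mult.commute)
    then have "int p ^ m dvd (s * z m) ^ (p ^ Suc k) - 1" by (simp add: cong_iff_dvd_diff)
    then have 3: "int p ^ (n + Suc k) dvd (s * z m) ^ (p ^ Suc k) - 1"
      by (rule dvd_trans[rotated]) (simp add: m_def)
    have "int p ^ n dvd s * z m - 1"
      by (rule lifting_the_exponent_converse[OF p 1 _ 3]) (rule 2)
    then have "[s * z m = 1] (mod int p ^ n)" by (simp add: cong_iff_dvd_diff)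
    moreover have "[s * z m = s * z n] (mod int p ^ n)"
      using z[of n m] by (intro cong_mult cong_refl) (simp add: m_def)
    ultimately show ?thesis by (meson cong_sym cong_trans)
  qed
  have "[z 1 = 1] (mod int p)"
    using root[of 1] int_fermat_power[OF p, of "z 1" k] by (simp add: cong_def)
  then have z1: "int p dvd z 1 - 1" by (simp add: cong_iff_dvd_diff)
  show ?thesis
  proof (cases "p = 2 \<longrightarrow> 4 dvd z 2 - 1")
    case True
    then show ?thesis using lift[of 1] z1 by auto
  next
    case False
    then have p2: "p = 2" by simp
    have "odd (z 1)" using z1 p2 by simp
    moreover have "z 2 mod 2 = z 1 mod 2" using z[of 1 2] p2 by (simp add: cong_def)
    moreover have "\<not> 4 dvd z 2 - 1" using False by simp
    ultimately have "4 dvd - 1 * z 2 - 1" by presburger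
    then have "[- 1 * z n = 1] (mod int p ^ n)" for n
      using \<open>odd (z 1)\<close> by (intro lift) (auto simp: p2)
    then have "[z n = - 1] (mod int p ^ n)" for n
      by (metis cong_minus_minus_iff minus_mult_left minus_minus mult_1)
    then show ?thesis using p2 by blast
  qed
qed

section \<open>Closed subgroups of the pro-2 dihedral group\<close>

text \<open>The least significant digit comes first, so the residue modulo 2^n is the node of depth
  \<open>n\<close> on the path \<open>d\<close>. This is how 2-adic integers become ends of the
  binary tree.\<close>

definition binary_value :: "(nat \<Rightarrow> bool) \<Rightarrow> nat \<Rightarrow> int" where
  "binary_value d n = (\<Sum>i<n. of_bool (d i) * 2 ^ i)"

lemma binary_value_Suc: "binary_value d (Suc n) = binary_value d n + of_bool (d n) * 2 ^ n"
  by (simp add: binary_value_def)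

lemma binary_value_bounds: "0 \<le> binary_value d n" "binary_value d n < 2 ^ n"
proof -
  show "0 \<le> binary_value d n" by (simp add: binary_value_def sum_nonneg)
  show "binary_value d n < 2 ^ n"
  proof (induction n)
    case (Suc n)
    have "binary_value d (Suc n) \<le> binary_value d n + 2 ^ n" by (simp add: binary_value_Suc)
    with Suc show ?case by simp
  qed (simp add: binary_value_def)
qed

lemma binary_value_in_padic_int: "binary_value d \<in> carrier (padic_int_group 2)"
  using binary_value_bounds[of d]
  by (auto simp: padic_int_group_def binary_value_Suc mod_pos_pos_trivial)

lemma binary_value_mod: "m \<le> n \<Longrightarrow> binary_value d n mod 2 ^ m = binary_value d m"
  using padic_int_mod[OF binary_value_in_padic_int] by simp

lemma binary_value_eq_iff:
  "binary_value d n = binary_value e n \<longleftrightarrow> (\<forall>i<n. d i = e i)"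
proof (induction n)
  case (Suc n)
  have "binary_value d (Suc n) = binary_value e (Suc n) \<longleftrightarrow>
      binary_value d n = binary_value e n \<and> d n = e n"
    using binary_value_bounds[of d n] binary_value_bounds[of e n]
    by (cases "d n"; cases "e n") (auto simp: binary_value_Suc)
  with Suc show ?case by (auto simp: less_Suc_eq)
qed (simp add: binary_value_def)

lemma padic_int_2_eq_binary_value:
  assumes x: "x \<in> carrier (padic_int_group 2)"
  obtains d where "x = binary_value d"
proof
  \<comment> \<open>The residue modulo 2^(i+1) is the residue modulo 2^i or that plus 2^i; digit
    \<open>i\<close> records whether it changes.\<close>
  define d where "d i \<longleftrightarrow> x (Suc i) \<noteq> x i" for i
  show "x = binary_value d"
  proof
    fix n
    show "x n = binary_value d n"
    proof (induction n)
      case 0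
      then show ?case using x by (simp add: padic_int_group_def binary_value_def)
          (metis atLeastLessThan_iff int_one_le_iff_zero_less less_le not_less power_0 zero_less_one)
    next
      case (Suc n)
      have "x (Suc n) \<in> {0..<2 ^ Suc n}" and mod: "x (Suc n) mod 2 ^ n = x n"
        using x by (simp_all add: padic_int_group_def del: power_Suc)
      then have x': "0 \<le> x (Suc n)" "x (Suc n) < 2 * 2 ^ n" "x (Suc n) mod 2 ^ n = x n"
        by simp_all
      define q where "q = x (Suc n) div 2 ^ n"
      have q: "x (Suc n) = q * 2 ^ n + x n"
        using x'(3) div_mult_mod_eq[of "x (Suc n)" "2 ^ n"] by (simp add: q_def)
      have "q < 2"
      proof (rule ccontr)
        assume "\<not> q < 2"
        then have "2 * 2 ^ n \<le> q * 2 ^ n" by (intro mult_right_mono) auto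
        moreover have "0 \<le> x n" using x by (simp add: padic_int_group_def)
        ultimately show False using q x' by linarith
      qed
      moreover have "0 \<le> q" using x' by (simp add: q_def pos_imp_zdiv_nonneg_iff)
      ultimately have "q = 0 \<or> q = 1" by auto
      with q show ?case by (auto simp: binary_value_Suc d_def Suc)
    qed
  qed
qed

lemma (in topological_group) continuous_mult_left: "x \<in> carrier G \<Longrightarrow> continuous_map T T (\<lambda>y. x \<otimes> y)"
  using continuous_map_compose[OF _ continuous_mult, of T "\<lambda>y. (x, y)"]
  by (simp add: comp_def topspace_eq continuous_map_pairwise)

section \<open>Coordinates on the pro-2 dihedral group\<close>

text \<open>Together with \<open>t_notin\<close>, the assumption \<open>notin_C\<close> says that
  \<open>C\<close> has index 2. The last two assumptions say that the subgroups 2^n C are a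
  neighbourhood base at the identity, which determines the topology by translation.\<close>

locale pro_2_dihedral_group = topological_group G T for G (structure) and T +
  fixes C :: "'a set" and \<phi> :: "'a \<Rightarrow> nat \<Rightarrow> int" and t :: 'a
  assumes C_normal: "C \<lhd> G"
    and phi_iso: "\<phi> \<in> iso (G\<lparr>carrier := C\<rparr>) (padic_int_group 2)"
    and t_carrier: "t \<in> carrier G" and t_notin: "t \<notin> C" and t_square: "t \<otimes> t = \<one>"
    and t_inverts: "c \<in> C \<Longrightarrow> t \<otimes> c = inv c \<otimes> t"
    and notin_C: "x \<in> carrier G \<Longrightarrow> x \<notin> C \<Longrightarrow> x \<otimes> t \<in> C"
    and congruence_open: "openin T {c \<in> C. \<phi> c n = 0}"
    and congruence_base: "openin T U \<Longrightarrow> \<one> \<in> U \<Longrightarrow> \<exists>n. {c \<in> C. \<phi> c n = 0} \<subseteq> U"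
begin

sublocale C: padic_subgroup G C \<phi> 2
  by (intro padic_subgroup.intro padic_subgroup_axioms.intro group_axioms
      normal_imp_subgroup[OF C_normal] phi_iso two_is_prime_nat)

lemmas C_carrier = C.mem_carrier and C_closed = C.closed
  and phi_padic = C.coord_padic and phi_bounds = C.coord_bounds[simplified]
  and phi_mod = C.coord_mod[simplified] and phi_mult = C.coord_mult[simplified]
  and phi_one = C.coord_one and phi_inv = C.coord_inv[simplified]
  and phi_eqI = C.coord_eqI

lemma phi_surj:
  obtains c where "c \<in> C" "\<phi> c = binary_value d"
  using C.coord_surj[OF binary_value_in_padic_int] .

text \<open>An element outside \<open>C\<close> is \<open>a \<otimes> t\<close> for a unique \<open>a \<in> C\<close>, and \<open>residue\<close> gives the coordinates
  of \<open>a\<close>.\<close>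

definition residue :: "'a \<Rightarrow> nat \<Rightarrow> int" where
  "residue x = (if x \<in> C then \<phi> x else \<phi> (x \<otimes> t))"

lemma residue_bounds: "x \<in> carrier G \<Longrightarrow> 0 \<le> residue x n" "x \<in> carrier G \<Longrightarrow> residue x n < 2 ^ n"
  by (simp_all add: residue_def phi_bounds notin_C)

lemma residue_mod: "x \<in> carrier G \<Longrightarrow> m \<le> n \<Longrightarrow> residue x n mod 2 ^ m = residue x m"
  by (simp add: residue_def phi_mod notin_C)

lemma residue_one: "residue \<one> n = 0"
  by (simp add: residue_def C_closed phi_one)

lemma eq_mult_t: "x \<in> carrier G \<Longrightarrow> x = (x \<otimes> t) \<otimes> t"
  by (simp add: m_assoc t_carrier t_square)

lemma C_mult_iff:
  assumes "c \<in> C" "x \<in> carrier G"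
  shows "c \<otimes> x \<in> C \<longleftrightarrow> x \<in> C" "x \<otimes> c \<in> C \<longleftrightarrow> x \<in> C"
proof -
  have "x = inv c \<otimes> (c \<otimes> x)" "x = (x \<otimes> c) \<otimes> inv c"
    using assms by (simp_all add: C_carrier m_assoc inv_solve_left)
  then show "c \<otimes> x \<in> C \<longleftrightarrow> x \<in> C" "x \<otimes> c \<in> C \<longleftrightarrow> x \<in> C"
    using assms C_closed by metis+
qed

text \<open>Since \<open>t\<close> inverts \<open>C\<close>, (a t) b = a b^-1 t and (a t) (b t) = a
  b^-1: a reflection on the left flips the sign of the other residue. With
  \<open>residue_eqI\<close> this turns group identities into congruences.\<close>

lemma residue_mult:
  assumes x: "x \<in> carrier G" and y: "y \<in> carrier G"
  shows "x \<otimes> y \<in> C \<longleftrightarrow> (x \<in> C \<longleftrightarrow> y \<in> C)"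
    and "residue (x \<otimes> y) n =
      (residue x n + (if x \<in> C then residue y n else - residue y n)) mod 2 ^ n"
proof -
  have "(x \<otimes> y \<in> C \<longleftrightarrow> (x \<in> C \<longleftrightarrow> y \<in> C)) \<and> residue (x \<otimes> y) n =
      (residue x n + (if x \<in> C then residue y n else - residue y n)) mod 2 ^ n"
  proof (cases "x \<in> C")
    case True
    with y show ?thesis
      by (auto simp: residue_def C_mult_iff phi_mult C_carrier m_assoc t_carrier notin_C)
  next
    case False
    define a where "a = x \<otimes> t"
    have a: "a \<in> C" "x = a \<otimes> t" "a \<in> carrier G"
      using False x by (auto simp: a_def notin_C C_carrier simp flip: eq_mult_t)
    have res_x: "residue x = \<phi> a"
      using False by (simp add: residue_def a_def)
    show ?thesis
    proof (cases "y \<in> C")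
      case True
      have "x \<otimes> y \<otimes> t = a \<otimes> (t \<otimes> y) \<otimes> t"
        using a True by (simp add: C_carrier t_carrier m_assoc)
      also have "\<dots> = a \<otimes> inv y"
        using a True by (simp add: C_carrier t_carrier t_inverts m_assoc t_square)
      finally have "x \<otimes> y \<otimes> t = a \<otimes> inv y" .
      moreover have "x \<otimes> y \<notin> C" using C_mult_iff(2)[OF True x] False by simp
      ultimately have "residue (x \<otimes> y) n = (\<phi> a n - \<phi> y n) mod 2 ^ n"
        by (simp add: residue_def phi_mult[OF a(1) C_closed(2)[OF True]] phi_inv[OF True] mod_simps)
      with \<open>x \<otimes> y \<notin> C\<close> True False show ?thesis
        unfolding res_x by (simp add: residue_def)
    next
      case y': False
      define b where "b = y \<otimes> t"
      have b: "b \<in> C" "y = b \<otimes> t" "b \<in> carrier G"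
        using y' y by (auto simp: b_def notin_C C_carrier simp flip: eq_mult_t)
      have "x \<otimes> y = a \<otimes> (t \<otimes> b) \<otimes> t"
        using a b by (simp add: t_carrier m_assoc)
      also have "\<dots> = a \<otimes> inv b"
        using a b by (simp add: t_carrier t_inverts m_assoc t_square)
      finally have xy: "x \<otimes> y = a \<otimes> inv b" .
      then have "x \<otimes> y \<in> C" using a(1) b(1) C_closed by simp
      moreover have "residue (x \<otimes> y) n = (\<phi> a n - \<phi> b n) mod 2 ^ n"
        using \<open>x \<otimes> y \<in> C\<close>
        by (simp add: residue_def xy phi_mult[OF a(1) C_closed(2)[OF b(1)]] phi_inv[OF b(1)] mod_simps)
      moreover have "residue y = \<phi> b" using y' by (simp add: residue_def b_def)
      ultimately show ?thesis
        using y' False unfolding res_x by simp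
    qed
  qed
  then show "x \<otimes> y \<in> C \<longleftrightarrow> (x \<in> C \<longleftrightarrow> y \<in> C)" "residue (x \<otimes> y) n =
      (residue x n + (if x \<in> C then residue y n else - residue y n)) mod 2 ^ n"
    by blast+
qed

lemma residue_eqI:
  assumes "x \<in> carrier G" "y \<in> carrier G" "x \<in> C \<longleftrightarrow> y \<in> C" "\<And>n. residue x n = residue y n"
  shows "x = y"
proof (cases "x \<in> C")
  case True
  then show ?thesis using assms by (auto simp: residue_def intro: phi_eqI)
next
  case False
  then have "x \<otimes> t = y \<otimes> t"
    using assms by (intro phi_eqI) (auto simp: residue_def notin_C)
  then show ?thesis using assms t_carrier by simp
qed

lemma involution: "x \<in> carrier G \<Longrightarrow> x \<notin> C \<Longrightarrow> inv x = x"
  by (intro inv_equality residue_eqI) (auto simp: residue_mult residue_one C_closed)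

lemma residue_inv:
  assumes "x \<in> carrier G"
  shows "inv x \<in> C \<longleftrightarrow> x \<in> C" "residue (inv x) n = (if x \<in> C then - residue x n mod 2 ^ n else residue x n)"
  using assms involution[of x]
  by (auto simp: residue_def C_closed phi_inv dest: C_closed(2))

lemma exists_reflection:
  obtains x where "x \<in> carrier G" "x \<notin> C" "residue x = binary_value d"
proof -
  obtain c where c: "c \<in> C" "\<phi> c = binary_value d" by (rule phi_surj)
  show ?thesis
  proof
    show "c \<otimes> t \<in> carrier G" using c by (simp add: C_carrier t_carrier)
    show "c \<otimes> t \<notin> C" using c C_mult_iff t_carrier t_notin by blast
    then show "residue (c \<otimes> t) = binary_value d"
      using c by (simp add: residue_def C_carrier t_carrier flip: eq_mult_t)
  qed
qed

section \<open>The two families of subgroups and their truncations\<close>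

definition rotations :: "enat \<Rightarrow> 'a set" where
  "rotations n = {x \<in> C. \<forall>k. enat k \<le> n \<longrightarrow> residue x k = 0}"

text \<open>As for \<open>rotations\<close>, membership is tested at every finite level k \<le> n
  instead of at level n, so that n = \<infinity> is covered by the same formula; there
  \<open>rotations\<close> is trivial and a single reflection is left.\<close>

definition dihedral :: "enat \<Rightarrow> (nat \<Rightarrow> bool) \<Rightarrow> 'a set" where
  "dihedral n d = {x \<in> carrier G. \<forall>k. enat k \<le> n \<longrightarrow>
     residue x k = (if x \<in> C then 0 else binary_value d k)}"

lemma rotations_enat: "rotations (enat n) = {c \<in> C. \<phi> c n = 0}"
  using phi_mod by (auto simp: rotations_def residue_def) (metis mod_0)

lemma dihedral_Int_C: "dihedral n d \<inter> C = rotations n"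
  by (auto simp: dihedral_def rotations_def C_carrier)

lemma rotations_subgroup: "subgroup (rotations n) G"
  by (rule subgroupI)
    (auto simp: rotations_def C_closed C_carrier residue_mult residue_inv residue_one
      intro: exI[of _ \<one>])

lemma dihedral_subgroup: "subgroup (dihedral n d) G"
proof (rule subgroupI)
  show "dihedral n d \<noteq> {}"
    by (auto simp: dihedral_def residue_one C_closed intro!: exI[of _ \<one>])
  have [simp]: "binary_value d k mod 2 ^ k = binary_value d k" for k
    by (rule binary_value_mod) simp
  fix x assume x: "x \<in> dihedral n d"
  then show "inv x \<in> dihedral n d"
    by (auto simp: dihedral_def residue_inv)
  fix y assume "y \<in> dihedral n d"
  with x show "x \<otimes> y \<in> dihedral n d"
    by (auto simp: dihedral_def residue_mult)
qed (auto simp: dihedral_def)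

lemma rotations_normal: "rotations n \<lhd> G"
proof -
  have "x \<otimes> h \<otimes> inv x \<in> rotations n" if "x \<in> carrier G" "h \<in> rotations n" for x h
    using that by (auto simp: rotations_def residue_mult residue_inv C_carrier mod_simps)
  then show ?thesis
    using rotations_subgroup by (simp add: normal_inv_iff)
qed

text \<open>Belonging to the same left coset of 2^m C, expressed by residues;
  \<open>congruent_iff\<close> is the translation.\<close>

definition congruent :: "nat \<Rightarrow> 'a \<Rightarrow> 'a \<Rightarrow> bool" where
  "congruent m x y \<longleftrightarrow> (x \<in> C \<longleftrightarrow> y \<in> C) \<and> residue x m = residue y m"

lemma congruent_iff:
  assumes x: "x \<in> carrier G" and y: "y \<in> carrier G"
  shows "inv x \<otimes> y \<in> rotations (enat m) \<longleftrightarrow> congruent m x y"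
proof -
  have "(a - b) mod 2 ^ m = 0 \<longleftrightarrow> a = b"
    if "0 \<le> a" "a < 2 ^ m" "0 \<le> b" "b < 2 ^ m" for a b :: int
    using that by (metis mod_eq_dvd_iff mod_0_imp_dvd dvd_imp_mod_0 mod_pos_pos_trivial)
  from this[OF residue_bounds[OF x] residue_bounds[OF y]]
    this[OF residue_bounds[OF y] residue_bounds[OF x]]
  have *: "(residue x m - residue y m) mod 2 ^ m = 0 \<longleftrightarrow> residue x m = residue y m"
    "(residue y m - residue x m) mod 2 ^ m = 0 \<longleftrightarrow> residue x m = residue y m" by auto
  have "z \<in> rotations (enat m) \<longleftrightarrow> z \<in> C \<and> residue z m = 0" for z
    by (auto simp: rotations_enat residue_def)
  then show ?thesis
    using x y * by (auto simp: congruent_def residue_mult residue_inv mod_simps)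
qed

lemma set_mult_rotations:
  assumes "H \<subseteq> carrier G"
  shows "H <#> rotations (enat m) = {y \<in> carrier G. \<exists>h\<in>H. congruent m h y}"
proof (intro equalityI subsetI)
  fix y assume "y \<in> H <#> rotations (enat m)"
  then obtain h r where h: "h \<in> H" "r \<in> rotations (enat m)" "y = h \<otimes> r"
    by (auto simp: set_mult_def)
  then have c: "h \<in> carrier G" "r \<in> carrier G"
    using assms by (auto simp: rotations_def C_carrier)
  then have "inv h \<otimes> y = r" by (simp add: h flip: m_assoc)
  then have "congruent m h y" using c h congruent_iff[of h y m] by simp
  with h c show "y \<in> {y \<in> carrier G. \<exists>h\<in>H. congruent m h y}" by auto
next
  fix y assume "y \<in> {y \<in> carrier G. \<exists>h\<in>H. congruent m h y}"
  then obtain h where h: "h \<in> H" "congruent m h y" "y \<in> carrier G" "h \<in> carrier G"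
    using assms by blast
  then have "inv h \<otimes> y \<in> rotations (enat m)" using congruent_iff by blast
  moreover have "y = h \<otimes> (inv h \<otimes> y)" using h by (simp flip: m_assoc)
  ultimately show "y \<in> H <#> rotations (enat m)"
    using h by (auto simp: set_mult_def)
qed

lemma congruent_mono:
  "congruent m x y \<Longrightarrow> x \<in> carrier G \<Longrightarrow> y \<in> carrier G \<Longrightarrow> k \<le> m \<Longrightarrow> congruent k x y"
  using residue_mod by (auto simp: congruent_def) (metis, metis)

text \<open>Multiplying by 2^k C forgets everything beyond level \<open>k\<close>, so on codes it is
  truncation; this matches the neighbourhoods in the space of subgroups with
  \<open>code_rel\<close>.\<close>

lemma rotations_set_mult: "rotations n <#> rotations (enat k) = rotations (min n (enat k))"
proof -
  have sub: "rotations n \<subseteq> carrier G" by (auto simp: rotations_def C_carrier)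
  show ?thesis
    unfolding set_mult_rotations[OF sub]
  proof (intro equalityI subsetI)
    fix y assume "y \<in> {y \<in> carrier G. \<exists>h\<in>rotations n. congruent k h y}"
    then obtain h where h: "y \<in> carrier G" "h \<in> rotations n" "congruent k h y" by blast
    then have "congruent j h y" if "j \<le> k" for j
      using congruent_mono[OF h(3)] sub that by blast
    with h show "y \<in> rotations (min n (enat k))"
      by (auto simp: rotations_def congruent_def)
  next
    fix y assume y: "y \<in> rotations (min n (enat k))"
    have "\<exists>h\<in>rotations n. congruent k h y"
    proof (cases "n \<le> enat k")
      case True
      with y show ?thesis by (auto simp: congruent_def min_def)
    next
      case False
      with y show ?thesis
        by (intro bexI[of _ \<one>]) (auto simp: congruent_def min_def rotations_def residue_one C_closed)
    qed
    with y show "y \<in> {y \<in> carrier G. \<exists>h\<in>rotations n. congruent k h y}"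
      by (auto simp: rotations_def C_carrier)
  qed
qed

lemma dihedral_set_mult: "dihedral n d <#> rotations (enat k) = dihedral (min n (enat k)) d"
proof -
  have sub: "dihedral n d \<subseteq> carrier G" by (auto simp: dihedral_def)
  show ?thesis
    unfolding set_mult_rotations[OF sub]
  proof (intro equalityI subsetI)
    fix y assume "y \<in> {y \<in> carrier G. \<exists>h\<in>dihedral n d. congruent k h y}"
    then obtain h where h: "y \<in> carrier G" "h \<in> dihedral n d" "congruent k h y" by blast
    then have "congruent j h y" if "j \<le> k" for j
      using congruent_mono[OF h(3)] sub that by blast
    with h show "y \<in> dihedral (min n (enat k)) d"
      by (auto simp: dihedral_def congruent_def)
  next
    fix y assume y: "y \<in> dihedral (min n (enat k)) d"
    have "\<exists>h\<in>dihedral n d. congruent k h y"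
    proof (cases "n \<le> enat k")
      case True
      with y show ?thesis by (auto simp: congruent_def min_def)
    next
      case False
      \<comment> \<open>The reflection with residues \<open>d\<close> at all levels lies in
        \<open>dihedral n d\<close> for every \<open>n\<close>, so it can stand for any reflection
        with the right residue at level \<open>k\<close>.\<close>
      obtain x where x: "x \<in> carrier G" "x \<notin> C" "residue x = binary_value d"
        by (rule exists_reflection)
      show ?thesis
      proof (cases "y \<in> C")
        case True
        with y False show ?thesis
          by (intro bexI[of _ \<one>]) (auto simp: congruent_def min_def dihedral_def residue_one C_closed)
      next
        case y': False
        with y False x show ?thesis
          by (intro bexI[of _ x]) (auto simp: congruent_def min_def dihedral_def)
      qed
    qed
    with y show "y \<in> {y \<in> carrier G. \<exists>h\<in>dihedral n d. congruent k h y}"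
      by (auto simp: dihedral_def)
  qed
qed

lemma rotations_not_subset:
  assumes "n < m"
  shows "\<not> rotations n \<subseteq> rotations m"
proof -
  obtain j where j: "n = enat j" using assms by (cases n) auto
  \<comment> \<open>\<open>c\<close> corresponds to the integer 2^j, which vanishes modulo 2^j but
    not modulo 2^(j+1).\<close>
  obtain c where c: "c \<in> C" "\<phi> c = binary_value (\<lambda>i. i = j)" by (rule phi_surj)
  have "binary_value (\<lambda>i. i = j) k = 0" if "k \<le> j" for k
    using that by (simp add: binary_value_def)
  moreover have "binary_value (\<lambda>i. i = j) (Suc j) = 2 ^ j"
    using calculation[of j] by (simp add: binary_value_Suc)
  moreover have "enat (Suc j) \<le> m" using assms j by (cases m) auto
  ultimately have "c \<in> rotations n" "c \<notin> rotations m"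
    using c j by (auto simp: rotations_def residue_def)
  then show ?thesis by blast
qed

lemma rotations_eq_iff: "rotations n = rotations m \<longleftrightarrow> n = m"
  using rotations_not_subset by (metis linorder_neqE order_refl)

text \<open>The level is recovered from the intersection with \<open>C\<close>, and the digits from
  the reflection with residues \<open>d\<close>, which lies in both groups.\<close>

lemma dihedral_eq_iff:
  "dihedral n d = dihedral m e \<longleftrightarrow> n = m \<and> (\<forall>i. enat i < n \<longrightarrow> d i = e i)"
proof (intro iffI conjI)
  assume eq: "dihedral n d = dihedral m e"
  then show nm: "n = m" by (metis dihedral_Int_C rotations_eq_iff)
  obtain x where x: "x \<in> carrier G" "x \<notin> C" "residue x = binary_value d"
    by (rule exists_reflection)
  then have "x \<in> dihedral n d" by (simp add: dihedral_def)
  then have "x \<in> dihedral m e" by (simp only: eq)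
  show "\<forall>i. enat i < n \<longrightarrow> d i = e i"
  proof (intro allI impI)
    fix i assume "enat i < n"
    then have "enat (Suc i) \<le> m" unfolding nm by (cases m) auto
    with \<open>x \<in> dihedral m e\<close> x have "binary_value d (Suc i) = binary_value e (Suc i)"
      by (simp add: dihedral_def)
    then show "d i = e i" by (simp add: binary_value_eq_iff)
  qed
next
  assume *: "n = m \<and> (\<forall>i. enat i < n \<longrightarrow> d i = e i)"
  have "binary_value d k = binary_value e k" if "enat k \<le> n" for k
    unfolding binary_value_eq_iff using * that by (metis enat_ord_simps(2) less_le_trans)
  with * show "dihedral n d = dihedral m e"
    unfolding dihedral_def by (intro Collect_cong) auto
qed

lemma rotations_neq_dihedral: "rotations n \<noteq> dihedral m d"
proof -
  obtain x where "x \<in> carrier G" "x \<notin> C" "residue x = binary_value d"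
    by (rule exists_reflection)
  then have "x \<in> dihedral m d" "x \<notin> rotations n"
    by (auto simp: dihedral_def rotations_def)
  then show ?thesis by blast
qed

section \<open>The topology of the group in terms of residues\<close>

lemma rotations_open: "openin T (rotations (enat n))"
  using congruence_open by (simp add: rotations_enat)

text \<open>The base 2^m C at the identity is carried to \<open>x\<close> by left translation, and
  the left cosets are the congruence classes.\<close>

lemma openin_iff_congruent:
  assumes "U \<subseteq> carrier G"
  shows "openin T U \<longleftrightarrow> (\<forall>x\<in>U. \<exists>m. \<forall>y\<in>carrier G. congruent m x y \<longrightarrow> y \<in> U)"
    (is "_ \<longleftrightarrow> ?R")
proof
  assume U: "openin T U"
  show ?R
  proof
    fix x assume x: "x \<in> U"
    then have xc: "x \<in> carrier G" using assms by blast
    have "openin T {y \<in> topspace T. x \<otimes> y \<in> U}"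
      using continuous_mult_left[OF xc] U by (rule openin_continuous_map_preimage)
    moreover have "\<one> \<in> {y \<in> topspace T. x \<otimes> y \<in> U}" using x xc by (simp add: topspace_eq)
    ultimately obtain m where m: "rotations (enat m) \<subseteq> {y \<in> topspace T. x \<otimes> y \<in> U}"
      using congruence_base rotations_enat by metis
    have "y \<in> U" if y: "y \<in> carrier G" "congruent m x y" for y
    proof -
      have "x \<otimes> (inv x \<otimes> y) \<in> U"
        using m congruent_iff[OF xc, of y m] y by blast
      then show ?thesis using xc y by (simp flip: m_assoc)
    qed
    then show "\<exists>m. \<forall>y\<in>carrier G. congruent m x y \<longrightarrow> y \<in> U" by blast
  qed
next
  assume R: ?R
  show "openin T U"
  proof (subst openin_subopen, intro ballI)
    fix x assume x: "x \<in> U"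
    with assms have xc: "x \<in> carrier G" by blast
    obtain m where m: "\<And>y. y \<in> carrier G \<Longrightarrow> congruent m x y \<Longrightarrow> y \<in> U" using R x by blast
    let ?V = "{y \<in> topspace T. inv x \<otimes> y \<in> rotations (enat m)}"
    have "openin T ?V"
      using continuous_mult_left[OF inv_closed[OF xc]] rotations_open
      by (rule openin_continuous_map_preimage)
    moreover have "x \<in> ?V" "?V \<subseteq> U"
      using m congruent_iff[OF xc] xc subgroup.one_closed[OF rotations_subgroup]
      by (auto simp: topspace_eq)
    ultimately show "\<exists>V. openin T V \<and> x \<in> V \<and> V \<subseteq> U" by blast
  qed
qed

lemma closedin_iff_congruent:
  assumes "A \<subseteq> carrier G"
  shows "closedin T A \<longleftrightarrow> (\<forall>x\<in>carrier G. (\<forall>m. \<exists>y\<in>A. congruent m x y) \<longrightarrow> x \<in> A)"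
proof -
  have sym: "congruent m x y \<longleftrightarrow> congruent m y x" for m x y
    by (auto simp: congruent_def)
  have "closedin T A \<longleftrightarrow> openin T (carrier G - A)"
    using assms by (simp add: closedin_def topspace_eq)
  also have "\<dots> \<longleftrightarrow> (\<forall>x\<in>carrier G. (\<forall>m. \<exists>y\<in>A. congruent m x y) \<longrightarrow> x \<in> A)"
    using assms by (subst openin_iff_congruent) blast+
  finally show ?thesis .
qed

section \<open>Classification of the closed subgroups\<close>

lemma rotations_closed: "closedin T (rotations n)"
proof -
  have "rotations n \<subseteq> carrier G" by (auto simp: rotations_def C_carrier)
  then show ?thesis
    unfolding closedin_iff_congruent[OF \<open>rotations n \<subseteq> carrier G\<close>]
    by (auto simp: rotations_def congruent_def) metis
qed

lemma dihedral_closed: "closedin T (dihedral n d)"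
proof -
  have "dihedral n d \<subseteq> carrier G" by (auto simp: dihedral_def)
  then show ?thesis
    unfolding closedin_iff_congruent[OF \<open>dihedral n d \<subseteq> carrier G\<close>]
    by (auto simp: dihedral_def congruent_def) metis+
qed

text \<open>As in the 2-adic integers, take an element of minimal valuation \<open>n\<close> in the
  intersection. Its powers approximate every element of 2^n C to any precision, and \<open>H\<close>
  is closed. If all residues vanish, the intersection is trivial and n = \<infinity>.\<close>

lemma closed_subgroup_Int_C:
  assumes H: "subgroup H G" "closedin T H"
  obtains n where "H \<inter> C = rotations n"
proof (cases "\<forall>x\<in>H \<inter> C. \<forall>k. \<phi> x k = 0")
  case True
  have "H \<inter> C = {\<one>}"
    using True H(1) by (auto simp: C_closed phi_one subgroup.one_closed intro!: phi_eqI)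
  moreover have "rotations \<infinity> = {\<one>}"
    by (auto simp: rotations_def residue_def C_closed phi_one intro!: phi_eqI)
  ultimately show ?thesis using that by metis
next
  case False
  define k where "k = (LEAST k. \<exists>x\<in>H \<inter> C. \<phi> x k \<noteq> 0)"
  have "\<exists>x\<in>H \<inter> C. \<phi> x k \<noteq> 0" unfolding k_def by (rule LeastI_ex) (use False in blast)
  then obtain x where x: "x \<in> H" "x \<in> C" "\<phi> x k \<noteq> 0" by blast
  have least: "\<phi> y j = 0" if "j < k" "y \<in> H \<inter> C" for j y
    using not_less_Least that unfolding k_def by blast
  \<comment> \<open>Residues modulo 1 vanish, so the first level \<open>k\<close> with a non-zero
    residue is positive, and the minimal valuation is k - 1.\<close>
  have "\<phi> x 0 = 0" using phi_bounds[OF x(2), of 0] by simp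
  with x obtain n where k: "k = Suc n" by (cases k) auto
  have "c \<in> H" if c: "c \<in> C" "\<phi> c n = 0" for c
  proof -
    have "\<exists>y\<in>H. congruent m c y" for m
    proof -
      have "\<exists>i::nat. \<phi> (x [^] i) m = \<phi> c m"
      proof (cases "m \<le> n")
        case True
        then have "\<phi> c m = 0" using phi_mod[OF c(1) True] c by simp
        then show ?thesis by (intro exI[of _ 0]) (simp add: phi_one)
      next
        case False
        then have "n \<le> m" "Suc n \<le> m" by auto
        from phi_mod[OF x(2) this(1)] phi_mod[OF x(2) this(2)] phi_mod[OF c(1) this(1)]
        have "\<phi> x m mod 2 ^ n = 0" "\<phi> x m mod 2 ^ Suc n \<noteq> 0" "\<phi> c m mod 2 ^ n = 0"
          using least[of n x] x c k by simp_all
        with exists_multiple_mod_prime_power[of 2 "\<phi> x m" n "\<phi> c m" m]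
        show ?thesis by (auto simp: C.coord_pow[OF x(2)] phi_mod[OF c(1), of m m])
      qed
      then obtain i :: nat where "\<phi> (x [^] i) m = \<phi> c m" by blast
      moreover have "x [^] i \<in> H" using x H(1) by (induction i) (auto intro: subgroup.m_closed subgroup.one_closed)
      ultimately show ?thesis
        using C.pow_closed[OF x(2)] c by (intro bexI[of _ "x [^] i"]) (auto simp: congruent_def residue_def)
    qed
    then show ?thesis
      using closedin_iff_congruent[of H] H c C_carrier subgroup.subset by blast
  qed
  then have "H \<inter> C = rotations (enat n)"
    using least k by (auto simp: rotations_enat)
  then show ?thesis by (rule that)
qed

text \<open>A reflection \<open>x\<close> of \<open>H\<close> is an involution, so another
  reflection \<open>y\<close> lies in \<open>H\<close> exactly if the rotation x y does. Hence
  \<open>x\<close> and the intersection with \<open>C\<close> determine \<open>H\<close>, and the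
  residues of \<open>x\<close> give the digits.\<close>

lemma closed_subgroup_cases:
  assumes H: "subgroup H G" "closedin T H"
  obtains n where "H = rotations n" | n d where "H = dihedral n d"
proof -
  obtain n where n: "H \<inter> C = rotations n" using closed_subgroup_Int_C[OF H] .
  have Hc: "H \<subseteq> carrier G" using H(1) by (rule subgroup.subset)
  show ?thesis
  proof (cases "H \<subseteq> C")
    case True
    then show ?thesis using n that(1) by blast
  next
    case False
    then obtain x where x: "x \<in> H" "x \<notin> C" "x \<in> carrier G" using Hc by blast
    then obtain d where d: "residue x = binary_value d"
      using padic_int_2_eq_binary_value[OF phi_padic[OF notin_C]] by (metis residue_def)
    have "y \<in> H \<longleftrightarrow> y \<in> dihedral n d" if y: "y \<in> carrier G" "y \<notin> C" for y
    proof -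
      have eq: "x \<otimes> y \<in> C" "y = x \<otimes> (x \<otimes> y)"
        using x y involution[of x] by (auto simp: residue_mult simp flip: m_assoc)
          (metis l_one r_inv)
      have "y \<in> H \<longleftrightarrow> x \<otimes> y \<in> H \<inter> C"
        using eq x H(1) subgroup.m_closed by (metis IntD1 IntI)
      also have "\<dots> \<longleftrightarrow> (\<forall>k. enat k \<le> n \<longrightarrow> residue (x \<otimes> y) k = 0)"
        using eq(1) by (auto simp: n rotations_def)
      also have "\<dots> \<longleftrightarrow> (\<forall>k. enat k \<le> n \<longrightarrow> residue y k = residue x k)"
      proof -
        have "residue (x \<otimes> y) k = 0 \<longleftrightarrow> residue y k = residue x k" for k
          using congruent_iff[of x y k] x y eq(1) involution[of x]
          by (auto simp: rotations_enat congruent_def residue_def)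
        then show ?thesis by simp
      qed
      also have "\<dots> \<longleftrightarrow> y \<in> dihedral n d" using y by (auto simp: dihedral_def d)
      finally show ?thesis .
    qed
    moreover have "y \<in> H \<longleftrightarrow> y \<in> dihedral n d" if "y \<in> C" for y
      using n dihedral_Int_C[of n d] that by blast
    ultimately have "y \<in> H \<longleftrightarrow> y \<in> dihedral n d" if "y \<in> carrier G" for y
      using that by blast
    moreover have "dihedral n d \<subseteq> carrier G" by (auto simp: dihedral_def)
    ultimately have "H = dihedral n d" using Hc by blast
    then show ?thesis by (rule that(2))
  qed
qed

lemma closed_subgroups_eq:
  "closed_subgroups G T = range rotations \<union> range (\<lambda>(n, d). dihedral n d)"
proof (intro equalityI subsetI)
  fix H assume "H \<in> closed_subgroups G T"
  then have "subgroup H G" "closedin T H" by (simp_all add: closed_subgroups_def)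
  then show "H \<in> range rotations \<union> range (\<lambda>(n, d). dihedral n d)"
    by (rule closed_subgroup_cases) auto
qed (auto simp: closed_subgroups_def rotations_subgroup dihedral_subgroup rotations_closed dihedral_closed)

section \<open>The space of closed subgroups\<close>

text \<open>Every open normal N contains some 2^k C, and then H N = (H 2^k C) N is determined by H
  2^k C. The subgroups 2^k C are themselves open and normal, so they give the same open
  sets.\<close>

lemma openin_subgroup_topology_rotations:
  assumes "U \<subseteq> closed_subgroups G T"
  shows "openin (subgroup_topology G T) U \<longleftrightarrow>
    (\<forall>H\<in>U. \<exists>k. \<forall>K\<in>closed_subgroups G T.
      H <#> rotations (enat k) = K <#> rotations (enat k) \<longrightarrow> K \<in> U)"
    (is "_ \<longleftrightarrow> ?R")
proof
  have sub: "H \<subseteq> carrier G" if "H \<in> closed_subgroups G T" for H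
    using that by (auto simp: closed_subgroups_def dest: subgroup.subset)
  assume U: "openin (subgroup_topology G T) U"
  show ?R
  proof
    fix H assume H: "H \<in> U"
    with U obtain N where N: "N \<lhd> G" "openin T N" "subgroup_nbhd G T H N \<subseteq> U"
      unfolding openin_subgroup_topology by blast
    have N': "subgroup N G" using N(1) by (rule normal_imp_subgroup)
    then have Nc: "N \<subseteq> carrier G" by (rule subgroup.subset)
    from N(2) subgroup.one_closed[OF N'] obtain k where k: "rotations (enat k) \<subseteq> N"
      using congruence_base rotations_enat by metis
    have kN: "rotations (enat k) <#> N = N"
    proof
      show "rotations (enat k) <#> N \<subseteq> N"
        using k N' by (auto simp: set_mult_def intro: subgroup.m_closed)
      show "N \<subseteq> rotations (enat k) <#> N"
        using Nc subgroup.one_closed[OF rotations_subgroup, of "enat k"] by (force simp: set_mult_def)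
    qed
    have assoc: "(K <#> rotations (enat k)) <#> N = K <#> N" if "K \<in> closed_subgroups G T" for K
      using set_mult_assoc[OF sub[OF that] subgroup.subset[OF rotations_subgroup] Nc] kN by simp
    have "K \<in> U"
      if "K \<in> closed_subgroups G T" "H <#> rotations (enat k) = K <#> rotations (enat k)" for K
    proof -
      have "K <#> N = H <#> N" using assoc[OF that(1)] assoc[of H] H assms that(2) by auto
      then show ?thesis using N(3) that(1) by (auto simp: subgroup_nbhd_def)
    qed
    then show "\<exists>k. \<forall>K\<in>closed_subgroups G T.
      H <#> rotations (enat k) = K <#> rotations (enat k) \<longrightarrow> K \<in> U" by blast
  qed
next
  assume R: ?R
  have "\<exists>N. N \<lhd> G \<and> openin T N \<and> subgroup_nbhd G T H N \<subseteq> U" if "H \<in> U" for H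
  proof -
    from R that obtain k where "\<forall>K\<in>closed_subgroups G T.
      H <#> rotations (enat k) = K <#> rotations (enat k) \<longrightarrow> K \<in> U" by blast
    then have "subgroup_nbhd G T H (rotations (enat k)) \<subseteq> U" by (auto simp: subgroup_nbhd_def)
    then show ?thesis using rotations_normal rotations_open by blast
  qed
  then show "openin (subgroup_topology G T) U"
    unfolding openin_subgroup_topology using assms by blast
qed

lemma topspace_subgroup_topology: "topspace (subgroup_topology G T) = closed_subgroups G T"
proof
  show "topspace (subgroup_topology G T) \<subseteq> closed_subgroups G T"
    using openin_subgroup_topology openin_topspace by blast
  have "openin (subgroup_topology G T) (closed_subgroups G T)"
    by (simp add: openin_subgroup_topology_rotations)
  then show "closed_subgroups G T \<subseteq> topspace (subgroup_topology G T)"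
    by (rule openin_subset)
qed

theorem subgroup_topology_homeomorphic:
  "subgroup_topology G T homeomorphic_space (pelczynski_space \<oplus>\<^sub>t\<^sub>o\<^sub>p omega_plus_one)"
proof -
  define g where "g = case_sum (\<lambda>x. dihedral (fst x) (snd x)) rotations"
  have range_g: "range g = closed_subgroups G T"
    unfolding closed_subgroups_eq g_def UNIV_sum image_Un
    by (simp add: image_image case_prod_beta Un_commute)
  \<comment> \<open>The products belong again to the two families, with truncated codes, so
    uniqueness of codes decides their equality.\<close>
  have eq_iff: "g i <#> rotations (enat k) = g j <#> rotations (enat k) \<longleftrightarrow> code_rel k i j" for i j k
    using rotations_neq_dihedral
    by (cases i; cases j) (auto simp: g_def rotations_set_mult dihedral_set_mult rotations_eq_iff
        dihedral_eq_iff node_rel_def dest: sym)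
  show ?thesis
  proof (rule homeomorphic_space_pelczynski_omega)
    show "range g = topspace (subgroup_topology G T)"
      by (simp add: range_g topspace_subgroup_topology)
    show "g i = g j \<longleftrightarrow> (\<forall>k. code_rel k i j)" for i j
    proof
      assume "\<forall>k. code_rel k i j"
      then show "g i = g j"
      proof (cases i; cases j)
        fix x y assume "\<forall>k. code_rel k i j" and ij: "i = Inl x" "j = Inl y"
        then have *: "node_rel k x y" for k by simp
        then have "fst x = fst y" by (subst enat_eq_iff_min) (simp add: node_rel_def)
        moreover have "snd x l = snd y l" if "enat l < fst x" for l
          using *[of "Suc l"] that by (simp add: node_rel_def)
        ultimately show ?thesis by (simp add: g_def ij dihedral_eq_iff)
      next
        fix n m assume "\<forall>k. code_rel k i j" and ij: "i = Inr n" "j = Inr m"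
        then have "n = m" by (subst enat_eq_iff_min) simp
        then show ?thesis by (simp add: g_def ij)
      qed auto
    qed (simp only: eq_iff[symmetric] simp_thms)
    show "openin (subgroup_topology G T) U \<longleftrightarrow>
        (\<forall>i. g i \<in> U \<longrightarrow> (\<exists>k. \<forall>j. code_rel k i j \<longrightarrow> g j \<in> U))"
      if "U \<subseteq> topspace (subgroup_topology G T)" for U
    proof -
      have U: "U \<subseteq> range g" using that by (simp add: range_g topspace_subgroup_topology)
      have "openin (subgroup_topology G T) U \<longleftrightarrow> (\<forall>H\<in>U. \<exists>k. \<forall>K\<in>range g.
          H <#> rotations (enat k) = K <#> rotations (enat k) \<longrightarrow> K \<in> U)"
        using U unfolding range_g by (rule openin_subgroup_topology_rotations)
      also have "\<dots> \<longleftrightarrow> (\<forall>i. g i \<in> U \<longrightarrow> (\<exists>k. \<forall>j.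
          g i <#> rotations (enat k) = g j <#> rotations (enat k) \<longrightarrow> g j \<in> U))"
      proof -
        have "(\<forall>H\<in>U. P H) \<longleftrightarrow> (\<forall>i. g i \<in> U \<longrightarrow> P (g i))" for P using U by blast
        then show ?thesis by (simp only: ball_simps UNIV_I simp_thms)
      qed
      finally show ?thesis by (simp only: eq_iff)
    qed
  qed
qed

end

section \<open>Virtually $p$-adic groups without finite normal subgroups\<close>

context group
begin

lemma conj_mult:
  "g \<in> carrier G \<Longrightarrow> x \<in> carrier G \<Longrightarrow> y \<in> carrier G \<Longrightarrow>
   g \<otimes> (x \<otimes> y) \<otimes> inv g = (g \<otimes> x \<otimes> inv g) \<otimes> (g \<otimes> y \<otimes> inv g)"
  by (simp add: m_assoc) (simp flip: m_assoc)

lemma conj_pow: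
  "g \<in> carrier G \<Longrightarrow> x \<in> carrier G \<Longrightarrow>
   g \<otimes> x [^] (i::nat) \<otimes> inv g = (g \<otimes> x \<otimes> inv g) [^] i"
  by (induction i) (simp_all add: conj_mult)

text \<open>The transfer is the product over all cosets X of s(X) g s(X g)^-1 for chosen
  representatives s(X). It is multiplicative because right translation permutes the cosets. A
  central n in \<open>N\<close> fixes every coset and each factor equals n, whence the
  power.\<close>

lemma transfer_central:
  assumes N: "subgroup N G" and central: "\<And>x n. x \<in> carrier G \<Longrightarrow> n \<in> N \<Longrightarrow> n \<otimes> x = x \<otimes> n"
    and fin: "finite (rcosets N)"
  obtains v where "v \<in> hom G (G\<lparr>carrier := N\<rparr>)" "\<And>n. n \<in> N \<Longrightarrow> v n = n [^] card (rcosets N)"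
proof -
  let ?N = "G\<lparr>carrier := N\<rparr>"
  have Nc: "N \<subseteq> carrier G" using N by (rule subgroup.subset)
  interpret N: comm_group ?N
    by (rule group.group_comm_groupI[OF subgroup_imp_group[OF N]]) (use central Nc in auto)
  define s where "s X = (SOME y. y \<in> X)" for X :: "'a set"
  have s: "s X \<in> X" "s X \<in> carrier G" "N #> s X = X" if X: "X \<in> rcosets N" for X
  proof -
    obtain x where x: "x \<in> carrier G" "X = N #> x" using X by (auto simp: RCOSETS_def)
    then have "x \<in> X" using rcos_self[OF _ N] by simp
    then show sX: "s X \<in> X" unfolding s_def by (rule someI)
    then show "s X \<in> carrier G" using x r_coset_subset_G[OF Nc] by blast
    show "N #> s X = X" using repr_independence[OF _ x(1) N, of "s X"] sX x(2) by simp
  qed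
  have shift: "X #> g \<in> rcosets N" if "X \<in> rcosets N" "g \<in> carrier G" for X g
    using that coset_mult_assoc[OF Nc] by (auto simp: RCOSETS_def)
  have assoc: "(X #> g) #> g' = X #> (g \<otimes> g')"
    if "X \<in> rcosets N" "g \<in> carrier G" "g' \<in> carrier G" for X g g'
    using that coset_mult_assoc[OF r_coset_subset_G[OF Nc]] by (auto simp: RCOSETS_def)
  have one: "X #> \<one> = X" if "X \<in> rcosets N" for X
    using that coset_mult_one[OF r_coset_subset_G[OF Nc]] by (auto simp: RCOSETS_def)
  define d where "d g X = s X \<otimes> g \<otimes> inv s (X #> g)" for g X
  have d: "d g X \<in> N" if X: "X \<in> rcosets N" and g: "g \<in> carrier G" for g X
  proof -
    have "N #> (s X \<otimes> g) = N #> s (X #> g)"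
      using s[OF X] s[OF shift[OF X g]] coset_mult_assoc[OF Nc _ g, of "s X"] by simp
    then have "s X \<otimes> g \<in> N #> s (X #> g)"
      using rcos_self[OF _ N] s[OF X] g by (metis m_closed)
    then show ?thesis
      unfolding d_def
      by (subst subgroup.rcos_module[OF N is_group, symmetric]) (use s X g shift in auto)
  qed
  \<comment> \<open>The cocycle identity: the representative of X g cancels in the middle.\<close>
  have d_mult: "d (g \<otimes> g') X = d g X \<otimes> d g' (X #> g)"
    if "X \<in> rcosets N" "g \<in> carrier G" "g' \<in> carrier G" for g g' X
    using that s(2) shift assoc by (simp add: d_def m_assoc) (simp flip: m_assoc)
  define v where "v g = finprod ?N (d g) (rcosets N)" for g
  show ?thesis
  proof
    show "v \<in> hom G ?N"
    proof (rule homI)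
      show "v g \<in> carrier ?N" if "g \<in> carrier G" for g
        unfolding v_def by (rule N.finprod_closed) (use d that in auto)
      fix g g' assume g: "g \<in> carrier G" "g' \<in> carrier G"
      have bij: "inj_on (\<lambda>X. X #> g) (rcosets N)" "(\<lambda>X. X #> g) ` (rcosets N) = rcosets N"
      proof -
        have inv: "(X #> g) #> inv g = X" "(X #> inv g) #> g = X" if "X \<in> rcosets N" for X
          using that g by (simp_all add: assoc one)
        then show "inj_on (\<lambda>X. X #> g) (rcosets N)"
          by (intro inj_on_inverseI[where g = "\<lambda>X. X #> inv g"])
        show "(\<lambda>X. X #> g) ` (rcosets N) = rcosets N"
        proof (intro equalityI subsetI)
          fix X assume "X \<in> rcosets N"
          then show "X \<in> (\<lambda>X. X #> g) ` (rcosets N)"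
            using inv(2) shift g by (intro image_eqI[of _ _ "X #> inv g"]) auto
        qed (use shift g in auto)
      qed
      have "finprod ?N (d g') (rcosets N) = finprod ?N (d g') ((\<lambda>X. X #> g) ` (rcosets N))"
        by (simp only: bij)
      also have "\<dots> = finprod ?N (\<lambda>X. d g' (X #> g)) (rcosets N)"
        by (rule N.finprod_reindex) (use d g bij in auto)
      finally have re: "finprod ?N (\<lambda>X. d g' (X #> g)) (rcosets N) = v g'"
        by (simp add: v_def)
      have "v (g \<otimes> g') = finprod ?N (\<lambda>X. d g X \<otimes>\<^bsub>?N\<^esub> d g' (X #> g)) (rcosets N)"
        unfolding v_def
        by (rule N.finprod_cong') (use d d_mult shift g in \<open>auto intro: subgroup.m_closed[OF N]\<close>)
      also have "\<dots> = v g \<otimes>\<^bsub>?N\<^esub> v g'"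
        unfolding re[symmetric] unfolding v_def
        by (rule N.finprod_multf) (use d shift g in auto)
      finally show "v (g \<otimes> g') = v g \<otimes>\<^bsub>?N\<^esub> v g'" .
    qed
    fix n assume n: "n \<in> N"
    have "d n X = n" if X: "X \<in> rcosets N" for X
    proof -
      have "X #> n = N #> (s X \<otimes> n)"
        using s[OF X] coset_mult_assoc[OF Nc, of "s X" n] n Nc by auto
      also have "\<dots> = N #> (n \<otimes> s X)" using central[OF s(2)[OF X] n] by simp
      also have "\<dots> = (N #> n) #> s X" using coset_mult_assoc[OF Nc, of n "s X"] n Nc s[OF X] by auto
      also have "\<dots> = X" using coset_join2[OF _ N n] s[OF X] n Nc by auto
      finally have "d n X = s X \<otimes> n \<otimes> inv s X" by (simp add: d_def)
      also have "\<dots> = n" using central[OF s(2)[OF X] n] s(2)[OF X] n Nc by (auto simp: m_assoc simp flip: central)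
      finally show ?thesis .
    qed
    then have "v n = finprod ?N (\<lambda>_. n) (rcosets N)"
      unfolding v_def by (intro N.finprod_cong') (use n in auto)
    also have "\<dots> = n [^] card (rcosets N)"
      using N.finprod_const[of n "rcosets N"] n nat_pow_consistent by simp
    finally show "v n = n [^] card (rcosets N)" .
  qed
qed

lemma pow_order_factgroup_mem:
  assumes N: "N \<lhd> G" and x: "x \<in> carrier G" and fin: "finite (rcosets N)"
  shows "x [^] order (G Mod N) \<in> N"
proof -
  interpret Q: group "G Mod N" by (rule normal.factorgroup_is_group[OF N])
  have sub: "subgroup N G" using N by (rule normal_imp_subgroup)
  have "(N #> x) [^]\<^bsub>G Mod N\<^esub> i = N #> x [^] i" for i :: nat
    by (induction i) (use x in \<open>auto simp: normal.rcos_sum[OF N] coset_mult_one subgroup.subset[OF sub]\<close>)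
  moreover have "(N #> x) [^]\<^bsub>G Mod N\<^esub> order (G Mod N) = \<one>\<^bsub>G Mod N\<^esub>"
    by (rule Q.pow_order_eq_1) (use x in \<open>auto simp: FactGroup_def RCOSETS_def\<close>)
  ultimately have "N #> x [^] order (G Mod N) = N" by (simp add: FactGroup_def)
  then show ?thesis using x coset_join1[OF _ _ sub] by auto
qed

end

section \<open>Neighbourhoods of the identity\<close>

lemma (in topological_group) open_subgroup_if_contains_open:
  assumes H: "subgroup H G" and U: "openin T U" "\<one> \<in> U" "U \<subseteq> H"
  shows "openin T H"
proof (subst openin_subopen, intro ballI)
  fix x assume x: "x \<in> H"
  then have xc: "x \<in> carrier G" using H subgroup.mem_carrier by metis
  let ?V = "{y \<in> topspace T. inv x \<otimes> y \<in> U}"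
  have "openin T ?V"
    using continuous_mult_left[OF inv_closed[OF xc]] U(1) by (rule openin_continuous_map_preimage)
  moreover have "x \<in> ?V" using xc U(2) by (simp add: topspace_eq)
  moreover have "?V \<subseteq> H"
  proof
    fix y assume y: "y \<in> ?V"
    then have "x \<otimes> (inv x \<otimes> y) \<in> H" using x U(3) H by (blast intro: subgroup.m_closed)
    then show "y \<in> H" using y xc by (simp add: topspace_eq flip: m_assoc)
  qed
  ultimately show "\<exists>V. openin T V \<and> x \<in> V \<and> V \<subseteq> H" by blast
qed

lemma openin_padic_int_congruence:
  assumes "p > 0"
  shows "openin (padic_int_topology p) {z \<in> carrier (padic_int_group p). z n = 0}"
proof -
  let ?X = "\<lambda>n. discrete_topology {0..<int p ^ n}"
  have "openin (?X n) {0}" using assms by simp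
  then have "openin (product_topology ?X UNIV) {z \<in> topspace (product_topology ?X UNIV). z n \<in> {0}}"
    by (intro openin_continuous_map_preimage[OF continuous_map_product_projection]) auto
  moreover have "{z \<in> carrier (padic_int_group p). z n = 0} =
      {z \<in> topspace (product_topology ?X UNIV). z n \<in> {0}} \<inter> carrier (padic_int_group p)"
    by (auto simp: padic_int_group_def)
  ultimately show ?thesis
    unfolding padic_int_topology_def openin_subtopology by blast
qed

text \<open>A basic open set of the product restricts finitely many coordinates, and a zero residue
  at level \<open>n\<close> forces zero at all lower levels.\<close>

lemma padic_int_congruence_base:
  assumes U: "openin (padic_int_topology p) U" and zero: "(\<lambda>n. 0) \<in> U"
  shows "\<exists>n. {z \<in> carrier (padic_int_group p). z n = 0} \<subseteq> U"
proof -
  let ?X = "\<lambda>n. discrete_topology {0..<int p ^ n}"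
  obtain V where V: "openin (product_topology ?X UNIV) V" "U = V \<inter> carrier (padic_int_group p)"
    using U by (auto simp: padic_int_topology_def openin_subtopology)
  then obtain W where W: "finite {i. W i \<noteq> topspace (?X i)}" "(\<lambda>n. 0) \<in> Pi\<^sub>E UNIV W"
    "Pi\<^sub>E UNIV W \<subseteq> V"
    using zero by (force simp: openin_product_topology_alt)
  define n where "n = Max (insert 0 {i. W i \<noteq> topspace (?X i)})"
  have "z \<in> U" if z: "z \<in> carrier (padic_int_group p)" "z n = 0" for z
  proof -
    have "z i \<in> W i" for i
    proof (cases "W i = topspace (?X i)")
      case True
      then show ?thesis using padic_int_bounds[OF z(1), of i] by simp
    next
      case False
      then have "i \<le> n" using W(1) by (simp add: n_def)
      then have "z i = 0" using padic_int_mod[OF z(1), of i n] z(2) by simp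
      then show ?thesis using W(2) by auto
    qed
    then show ?thesis using V(2) W(3) z(1) by auto
  qed
  then show ?thesis by blast
qed

text \<open>\<open>no_finite_normal\<close> is what is kept of being just-infinite, and
  \<open>index\<close> what is kept of being pro-p.\<close>

locale padic_extension = topological_group G T for G (structure) and T +
  fixes N :: "'a set" and h :: "'a \<Rightarrow> nat \<Rightarrow> int" and p k :: nat
  assumes N_normal: "N \<lhd> G" and N_open: "openin T N"
    and h_iso: "h \<in> iso (G\<lparr>carrier := N\<rparr>) (padic_int_group p)"
    and h_homeo: "homeomorphic_map (subtopology T N) (padic_int_topology p) h"
    and prime: "prime p" and index: "order (G Mod N) = p ^ k"
    and no_finite_normal: "K \<lhd> G \<Longrightarrow> finite K \<Longrightarrow> K = {\<one>}"
begin

sublocale N: padic_subgroup G N h p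
  by (intro padic_subgroup.intro padic_subgroup_axioms.intro group_axioms
      normal_imp_subgroup[OF N_normal] h_iso prime)

lemma N_congruence_open: "openin T {x \<in> N. h x n = 0}"
proof -
  have top: "topspace (subtopology T N) = N"
    using openin_subset[OF N_open] by auto
  have "continuous_map (subtopology T N) (padic_int_topology p) h"
    using h_homeo by (rule homeomorphic_imp_continuous_map)
  then have "openin (subtopology T N)
      {x \<in> N. h x \<in> {z \<in> carrier (padic_int_group p). z n = 0}}"
    using openin_continuous_map_preimage[OF _ openin_padic_int_congruence, of "subtopology T N" p h n]
      prime_gt_0_nat[OF prime] unfolding top by simp
  moreover have "{x \<in> N. h x \<in> {z \<in> carrier (padic_int_group p). z n = 0}} = {x \<in> N. h x n = 0}"
    using N.coord_padic by auto
  ultimately show ?thesis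
    using openin_trans_full[OF _ N_open] by simp
qed

lemma N_congruence_base:
  assumes U: "openin T U" "\<one> \<in> U"
  shows "\<exists>n. {x \<in> N. h x n = 0} \<subseteq> U"
proof -
  have "openin (subtopology T N) (U \<inter> N)" using U(1) by (auto simp: openin_subtopology)
  then have "openin (padic_int_topology p) (h ` (U \<inter> N))"
    using h_homeo by (meson homeomorphic_map_openness openin_subset)
  moreover have "(\<lambda>n. 0) \<in> h ` (U \<inter> N)"
    using U(2) N.closed(1) N.coord_one by (intro image_eqI[of _ _ "\<one>"]) auto
  ultimately obtain n where n: "{z \<in> carrier (padic_int_group p). z n = 0} \<subseteq> h ` (U \<inter> N)"
    using padic_int_congruence_base by blast
  have "x \<in> U" if x: "x \<in> N" "h x n = 0" for x
  proof -
    have "h x \<in> h ` (U \<inter> N)" using n x N.coord_padic by blast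
    then obtain y where "y \<in> U" "y \<in> N" "h x = h y" by blast
    then show ?thesis using N.coord_eqI[OF x(1), of y] by simp
  qed
  then show ?thesis by blast
qed

lemma index_pos: "p ^ k > 0"
  using prime by (simp add: prime_gt_0_nat)

lemma finite_rcosets: "finite (rcosets N)"
  using index index_pos by (metis FactGroup_def card.infinite less_irrefl order_def partial_object.select_convs(1))

lemma pow_index_mem: "x \<in> carrier G \<Longrightarrow> x [^] (p ^ k) \<in> N"
  using pow_order_factgroup_mem[OF N_normal _ finite_rcosets] index by simp

lemma conj_mem: "g \<in> carrier G \<Longrightarrow> x \<in> N \<Longrightarrow> g \<otimes> x \<otimes> inv g \<in> N"
  using N_normal by (rule normal.inv_op_closed2)

section \<open>The centralizer of the open subgroup\<close>

definition C :: "'a set" where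
  "C = {g \<in> carrier G. \<forall>x\<in>N. g \<otimes> x = x \<otimes> g}"

lemma C_carrier: "c \<in> C \<Longrightarrow> c \<in> carrier G"
  by (simp add: C_def)

lemma N_subset_C: "N \<subseteq> C"
  using N.mem_carrier N.commutes by (auto simp: C_def)

lemma mem_C_iff_conj:
  assumes "g \<in> carrier G"
  shows "g \<in> C \<longleftrightarrow> (\<forall>x\<in>N. g \<otimes> x \<otimes> inv g = x)"
proof -
  have "g \<otimes> x = x \<otimes> g \<longleftrightarrow> g \<otimes> x \<otimes> inv g = x" if "x \<in> N" for x
    using inv_solve_right[of x "g \<otimes> x" g] N.mem_carrier[OF that] assms by auto
  then show ?thesis using assms by (auto simp: C_def)
qed

lemma conj_comp:
  "g \<in> carrier G \<Longrightarrow> g' \<in> carrier G \<Longrightarrow> x \<in> carrier G \<Longrightarrow>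
   (g \<otimes> g') \<otimes> x \<otimes> inv (g \<otimes> g') = g \<otimes> (g' \<otimes> x \<otimes> inv g') \<otimes> inv g"
  by (simp add: inv_mult_group m_assoc)

lemma C_subgroup: "subgroup C G"
proof (rule subgroupI)
  show "C \<noteq> {}" using N_subset_C N.closed(1) by blast
  fix c assume c: "c \<in> C"
  show "inv c \<in> C"
    unfolding mem_C_iff_conj[OF inv_closed[OF C_carrier[OF c]]]
  proof
    fix x assume x: "x \<in> N"
    then have "c \<otimes> x = x \<otimes> c" using c by (simp add: C_def)
    then show "inv c \<otimes> x \<otimes> inv (inv c) = x"
      using C_carrier[OF c] N.mem_carrier[OF x] by (simp add: m_assoc flip: \<open>c \<otimes> x = x \<otimes> c\<close>) (simp flip: m_assoc)
  qed
  fix e assume e: "e \<in> C"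
  show "c \<otimes> e \<in> C"
    using c e unfolding mem_C_iff_conj[OF m_closed[OF C_carrier[OF c] C_carrier[OF e]]]
    by (metis C_carrier N.mem_carrier conj_comp mem_C_iff_conj)
qed (auto simp: C_carrier)

lemma C_closed: "\<one> \<in> C" "c \<in> C \<Longrightarrow> inv c \<in> C" "c \<in> C \<Longrightarrow> e \<in> C \<Longrightarrow> c \<otimes> e \<in> C"
  using C_subgroup by (auto intro: subgroup.one_closed subgroup.m_inv_closed subgroup.m_closed)

lemma C_pow_closed: "c \<in> C \<Longrightarrow> c [^] (i::nat) \<in> C"
  by (induction i) (auto simp: C_closed)

lemma C_normal: "C \<lhd> G"
proof -
  have "g \<otimes> c \<otimes> inv g \<in> C" if g: "g \<in> carrier G" and c: "c \<in> C" for g c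
  proof -
    have gc: "g \<otimes> c \<otimes> inv g \<in> carrier G" using g C_carrier[OF c] by simp
    have "(g \<otimes> c \<otimes> inv g) \<otimes> x \<otimes> inv (g \<otimes> c \<otimes> inv g) = x" if x: "x \<in> N" for x
    proof -
      have "inv g \<otimes> x \<otimes> inv (inv g) \<in> N" using conj_mem[of "inv g"] g x by simp
      then have "c \<otimes> (inv g \<otimes> x \<otimes> inv (inv g)) \<otimes> inv c = inv g \<otimes> x \<otimes> inv (inv g)"
        using c mem_C_iff_conj[OF C_carrier[OF c]] by blast
      then have "(g \<otimes> c \<otimes> inv g) \<otimes> x \<otimes> inv (g \<otimes> c \<otimes> inv g) = g \<otimes> (inv g \<otimes> x \<otimes> inv (inv g)) \<otimes> inv g"
        using g C_carrier[OF c] N.mem_carrier[OF x] by (simp only: conj_comp m_closed inv_closed)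
      also have "\<dots> = (g \<otimes> inv g) \<otimes> x \<otimes> inv (g \<otimes> inv g)"
        using g N.mem_carrier[OF x] by (simp only: conj_comp inv_closed)
      also have "\<dots> = x" using g N.mem_carrier[OF x] by simp
      finally show ?thesis .
    qed
    then show ?thesis using mem_C_iff_conj[OF gc] by blast
  qed
  then show ?thesis using C_subgroup by (simp add: normal_inv_iff)
qed

text \<open>The torsion of \<open>C\<close> is the kernel of the transfer into the central subgroup \<open>N\<close>;
  it is a finite normal subgroup of \<open>G\<close>, hence trivial.\<close>

lemma exists_injective_transfer:
  obtains v where "\<And>c. c \<in> C \<Longrightarrow> v c \<in> N"
    and "\<And>c e. c \<in> C \<Longrightarrow> e \<in> C \<Longrightarrow> v (c \<otimes> e) = v c \<otimes> v e"
    and "\<And>c. c \<in> C \<Longrightarrow> v c = \<one> \<Longrightarrow> c = \<one>" and "v \<one> = \<one>"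
proof -
  let ?C = "G\<lparr>carrier := C\<rparr>"
  interpret GC: group ?C by (rule subgroup_imp_group[OF C_subgroup])
  have sub: "subgroup N ?C"
    using subgroup_incl[OF N.subgroup C_subgroup N_subset_C] .
  have cosets: "rcosets\<^bsub>?C\<^esub> N \<subseteq> rcosets N"
    using C_carrier by (auto simp: RCOSETS_def r_coset_def)
  define m where "m = card (rcosets\<^bsub>?C\<^esub> N)"
  have "finite (rcosets\<^bsub>?C\<^esub> N)" using cosets finite_rcosets by (rule finite_subset)
  moreover have "rcosets\<^bsub>?C\<^esub> N \<noteq> {}" using C_closed(1) by (auto simp: RCOSETS_def)
  ultimately have m: "m > 0" by (simp add: m_def card_gt_0_iff)
  obtain v where v: "v \<in> hom ?C (?C\<lparr>carrier := N\<rparr>)"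
    "\<And>n. n \<in> N \<Longrightarrow> v n = n [^]\<^bsub>?C\<^esub> card (rcosets\<^bsub>?C\<^esub> N)"
    by (rule GC.transfer_central[OF sub _ \<open>finite (rcosets\<^bsub>?C\<^esub> N)\<close>]) (auto simp: C_def)
  have v_N: "v n = n [^] m" if "n \<in> N" for n
    using v(2)[OF that] nat_pow_consistent by (simp add: m_def)
  have v_mem: "v c \<in> N" if "c \<in> C" for c using v(1) that by (auto simp: hom_def)
  have v_mult: "v (c \<otimes> e) = v c \<otimes> v e" if "c \<in> C" "e \<in> C" for c e
    using v(1) that by (auto simp: hom_def)
  have v_one: "v \<one> = \<one>" using v_N[OF N.closed(1)] by simp
  have v_pow: "v (c [^] i) = v c [^] i" if "c \<in> C" for c and i :: nat
    using that by (induction i) (auto simp: v_one v_mult C_pow_closed)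
  have v_inv: "v (inv c) = inv (v c)" if "c \<in> C" for c
    using v_mult[OF C_closed(2)[OF that] that] that v_mem C_closed(2)
    by (intro inv_equality[symmetric]) (auto simp: C_carrier v_one N.mem_carrier)
  \<comment> \<open>Described by the exponent p^k, the kernel no longer refers to \<open>v\<close>;
    this makes it invariant under conjugation by all of \<open>G\<close>, although \<open>v\<close>
    is defined on \<open>C\<close> only.\<close>
  have ker_iff: "v c = \<one> \<longleftrightarrow> c [^] (p ^ k) = \<one>" if c: "c \<in> C" for c
  proof
    assume "v c = \<one>"
    then have "(c [^] (p ^ k)) [^] m = \<one>"
      using v_N[OF pow_index_mem[OF C_carrier[OF c]]] v_pow[OF c] by simp
    then show "c [^] (p ^ k) = \<one>"
      using N.torsion_free[OF pow_index_mem[OF C_carrier[OF c]]] m by blast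
  next
    assume "c [^] (p ^ k) = \<one>"
    then have "v c [^] (p ^ k) = \<one>" using v_pow[OF c, of "p ^ k"] v_one by simp
    then show "v c = \<one>" using N.torsion_free[OF v_mem[OF c]] index_pos by blast
  qed
  define K where "K = {c \<in> C. v c = \<one>}"
  have K_sub: "subgroup K G"
    by (rule subgroupI) (auto simp: K_def C_closed C_carrier v_mult v_inv v_one intro!: exI[of _ "\<one>"])
  have "g \<otimes> c \<otimes> inv g \<in> K" if g: "g \<in> carrier G" and c: "c \<in> K" for g c
  proof -
    have c': "c \<in> C" "c [^] (p ^ k) = \<one>" using c ker_iff by (auto simp: K_def)
    have "g \<otimes> c \<otimes> inv g \<in> C" using normal.inv_op_closed2[OF C_normal g c'(1)] .
    moreover have "(g \<otimes> c \<otimes> inv g) [^] (p ^ k) = \<one>"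
      using conj_pow[OF g C_carrier[OF c'(1)], of "p ^ k"] c'(2) g by simp
    ultimately show ?thesis using ker_iff by (simp add: K_def)
  qed
  then have "K \<lhd> G" using K_sub by (simp add: normal_inv_iff)
  \<comment> \<open>On \<open>N\<close> the map \<open>v\<close> is the m-th power, which kills only
    the identity there, so the kernel has at most one element in each coset of
    \<open>N\<close>.\<close>
  moreover have "finite K"
  proof (rule finite_imageD)
    show "finite ((\<lambda>c. N #> c) ` K)"
      using finite_rcosets by (rule finite_subset[rotated]) (auto simp: RCOSETS_def K_def intro: C_carrier)
    show "inj_on (\<lambda>c. N #> c) K"
    proof (rule inj_onI)
      fix c e assume c: "c \<in> K" and e: "e \<in> K" and eq: "N #> c = N #> e"
      then have ce: "c \<in> carrier G" "e \<in> carrier G" by (auto simp: K_def C_carrier)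
      then have "c \<in> N #> e" using rcos_self[OF ce(1) N.subgroup] eq by simp
      then have "c \<otimes> inv e \<in> N"
        using subgroup.rcos_module[OF N.subgroup group_axioms ce(2,1)] by simp
      moreover have "v (c \<otimes> inv e) = \<one>"
        using c e by (simp add: K_def v_mult v_inv C_closed)
      ultimately have "c \<otimes> inv e = \<one>" using v_N N.torsion_free m by metis
      then show "c = e" using ce inv_equality[of c "inv e"] by simp
    qed
  qed
  ultimately have "K = {\<one>}" by (rule no_finite_normal)
  then have "c = \<one>" if "c \<in> C" "v c = \<one>" for c using that by (auto simp: K_def)
  with v_mem v_mult v_one show ?thesis using that by blast
qed

text \<open>The injective transfer takes values in the abelian group \<open>N\<close>, so it kills
  commutators.\<close>

lemma C_commutes:
  assumes c: "c \<in> C" and e: "e \<in> C"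
  shows "c \<otimes> e = e \<otimes> c"
proof -
  obtain v where v: "\<And>c. c \<in> C \<Longrightarrow> v c \<in> N"
    "\<And>c e. c \<in> C \<Longrightarrow> e \<in> C \<Longrightarrow> v (c \<otimes> e) = v c \<otimes> v e"
    "\<And>c. c \<in> C \<Longrightarrow> v c = \<one> \<Longrightarrow> c = \<one>" "v \<one> = \<one>"
    by (rule exists_injective_transfer) blast
  let ?d = "(c \<otimes> e) \<otimes> inv (e \<otimes> c)"
  have d: "?d \<in> C" using c e by (simp add: C_closed)
  have "v ?d = v (c \<otimes> e) \<otimes> v (inv (e \<otimes> c))" using c e by (simp add: v(2) C_closed)
  also have "v (c \<otimes> e) = v (e \<otimes> c)" using c e v(1,2) N.commutes by simp
  also have "v (e \<otimes> c) \<otimes> v (inv (e \<otimes> c)) = v ((e \<otimes> c) \<otimes> inv (e \<otimes> c))"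
    using c e by (simp add: v(2) C_closed)
  also have "\<dots> = \<one>" using c e v(4) by (simp add: C_carrier)
  finally have "?d = \<one>" using v(3)[OF d] by simp
  then show ?thesis
    using inv_equality[of "c \<otimes> e" "inv (e \<otimes> c)"] c e by (simp add: C_carrier)
qed

lemma C_torsion_free:
  assumes c: "c \<in> C" and "c [^] (i::nat) = \<one>" "i > 0"
  shows "c = \<one>"
proof -
  obtain v where v: "\<And>c. c \<in> C \<Longrightarrow> v c \<in> N"
    "\<And>c e. c \<in> C \<Longrightarrow> e \<in> C \<Longrightarrow> v (c \<otimes> e) = v c \<otimes> v e"
    "\<And>c. c \<in> C \<Longrightarrow> v c = \<one> \<Longrightarrow> c = \<one>" "v \<one> = \<one>"
    by (rule exists_injective_transfer) blast
  have "v (c [^] i) = v c [^] i"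
    using c by (induction i) (auto simp: v(2,4) C_pow_closed)
  then have "v c [^] i = \<one>" using assms v(4) by simp
  then have "v c = \<one>" using N.torsion_free[OF v(1)[OF c]] assms(3) by blast
  then show ?thesis by (rule v(3)[OF c])
qed

lemma C_pow_mult: "c \<in> C \<Longrightarrow> e \<in> C \<Longrightarrow> (c \<otimes> e) [^] (i::nat) = c [^] i \<otimes> e [^] i"
  using pow_mult_distrib C_commutes C_carrier by metis

lemma C_pow_inj:
  assumes c: "c \<in> C" and e: "e \<in> C" and eq: "c [^] (i::nat) = e [^] i" and i: "i > 0"
  shows "c = e"
proof -
  have "(c \<otimes> inv e) [^] i = \<one>"
    using C_pow_mult[OF c C_closed(2)[OF e]] eq c e by (simp add: nat_pow_inv C_carrier)
  then have "c \<otimes> inv e = \<one>" using C_torsion_free[of "c \<otimes> inv e"] c e i by (simp add: C_closed)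
  then show ?thesis using inv_equality[of c "inv e"] c e by (simp add: C_carrier)
qed

section \<open>The action on the open subgroup by conjugation\<close>

text \<open>The element 1 of the p-adic integers; the \<open>mod\<close> matters only at n = 0,
  where the residue has to be 0.\<close>

definition generator :: 'a where
  "generator = (SOME e. e \<in> N \<and> (\<forall>n. h e n = 1 mod int p ^ n))"

lemma generator: "generator \<in> N" "h generator n = 1 mod int p ^ n"
proof -
  have "(\<lambda>n. 1 mod int p ^ n) \<in> carrier (padic_int_group p)"
    using N.power_pos by (simp add: padic_int_group_def mod_mod_cancel)
  then obtain e where "e \<in> N" "h e = (\<lambda>n. 1 mod int p ^ n)" by (rule N.coord_surj)
  then have "\<exists>e. e \<in> N \<and> (\<forall>n. h e n = 1 mod int p ^ n)" by auto
  then have "generator \<in> N \<and> (\<forall>n. h generator n = 1 mod int p ^ n)"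
    unfolding generator_def by (rule someI_ex)
  then show "generator \<in> N" "h generator n = 1 mod int p ^ n" by auto
qed

text \<open>Conjugation by \<open>g\<close> acts on \<open>N\<close> as multiplication by a p-adic
  unit, and the image of 1 gives its residues.\<close>

definition unit :: "'a \<Rightarrow> nat \<Rightarrow> int" where
  "unit g = h (g \<otimes> generator \<otimes> inv g)"

text \<open>Modulo the subgroup \<open>N\<^sup>m\<close> with \<open>m = p\<^sup>n\<close>, which is characteristic in \<open>N\<close>, every element of
  \<open>N\<close> is a power of the generator.\<close>

lemma coord_conj:
  assumes g: "g \<in> carrier G" and x: "x \<in> N"
  shows "h (g \<otimes> x \<otimes> inv g) n = unit g n * h x n mod int p ^ n"
proof -
  let ?e = "generator"
  define j where "j = nat (h x n)"
  have j: "int j = h x n" using N.coord_bounds(1)[OF x] by (simp add: j_def)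
  define y where "y = inv (?e [^] j) \<otimes> x"
  have ej: "?e [^] j \<in> N" using generator(1) by (rule N.pow_closed)
  then have y: "y \<in> N" using x by (simp add: y_def N.closed)
  have "h (?e [^] j) n = h x n"
    using N.coord_pow[OF generator(1)] N.coord_mod[OF x, of n n] by (simp add: generator(2) j mod_simps)
  then have "h y n = 0"
    using N.coord_mult[OF N.closed(2)[OF ej] x] N.coord_inv[OF ej] by (simp add: y_def mod_simps)
  \<comment> \<open>The conjugate of a p^n-th power is again a p^n-th power and has zero residue at
    level \<open>n\<close>; therefore only the power of the generator contributes.\<close>
  then obtain w where w: "w \<in> N" "w [^] (p ^ n) = y" by (rule N.exists_root[OF y])
  have gw: "g \<otimes> w \<otimes> inv g \<in> N" "g \<otimes> ?e \<otimes> inv g \<in> N"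
    using conj_mem[OF g] w(1) generator(1) by auto
  have "x = ?e [^] j \<otimes> y"
    using N.mem_carrier[OF ej] N.mem_carrier[OF x] by (simp add: y_def flip: m_assoc)
  then have "g \<otimes> x \<otimes> inv g = (g \<otimes> ?e [^] j \<otimes> inv g) \<otimes> (g \<otimes> y \<otimes> inv g)"
    using conj_mult[OF g N.mem_carrier[OF ej] N.mem_carrier[OF y]] by simp
  also have "\<dots> = (g \<otimes> ?e \<otimes> inv g) [^] j \<otimes> (g \<otimes> w \<otimes> inv g) [^] (p ^ n)"
    using w conj_pow[OF g] N.mem_carrier generator(1) by metis
  finally show ?thesis
    using N.coord_mult[OF N.pow_closed[OF gw(2)] N.pow_closed[OF gw(1)]]
    by (simp add: N.coord_pow[OF gw(1)] N.coord_pow[OF gw(2)] unit_def j mod_simps mult.commute)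
qed

lemma unit_mult:
  assumes "g \<in> carrier G" "g' \<in> carrier G"
  shows "unit (g \<otimes> g') n = unit g n * unit g' n mod int p ^ n"
  using coord_conj[OF assms(1) conj_mem[OF assms(2) generator(1)]] assms
  by (simp add: unit_def conj_comp N.mem_carrier[OF generator(1)])

lemma unit_one: "unit \<one> n = 1 mod int p ^ n"
  by (simp add: unit_def N.mem_carrier generator)

lemma unit_pow: "g \<in> carrier G \<Longrightarrow> unit (g [^] (i::nat)) n = unit g n ^ i mod int p ^ n"
  by (induction i) (auto simp: unit_one unit_mult mod_simps mult.commute)

lemma conj_trivial_or_inverts:
  assumes g: "g \<in> carrier G"
  shows "g \<in> C \<or> p = 2 \<and> (\<forall>x\<in>N. g \<otimes> x \<otimes> inv g = inv x)"
proof -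
  have g_N: "g \<otimes> x \<otimes> inv g \<in> N" if "x \<in> N" for x using conj_mem[OF g that] .
  have "[unit g n = unit g m] (mod int p ^ m)" if "m \<le> n" for m n
    using N.coord_mod[OF g_N[OF generator(1)] that] N.coord_mod[OF g_N[OF generator(1)], of m m]
    by (simp add: unit_def cong_def)
  moreover have "[unit g n ^ (p ^ k) = 1] (mod int p ^ n)" for n
  proof -
    \<comment> \<open>This power lies in the abelian group \<open>N\<close> and acts trivially on
      it, so the unit of \<open>g\<close> is a root of unity of p-power order.\<close>
    let ?z = "g [^] (p ^ k)"
    have z: "?z \<in> N" using g by (rule pow_index_mem)
    have "?z \<otimes> generator \<otimes> inv ?z = generator"
      using N.commutes[OF z generator(1)] N.mem_carrier[OF z] N.mem_carrier[OF generator(1)]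
      by (simp add: m_assoc)
    then have "unit ?z n = 1 mod int p ^ n" by (simp add: unit_def generator)
    then show ?thesis using unit_pow[OF g, of "p ^ k" n] by (simp add: cong_def)
  qed
  ultimately consider "\<And>n. [unit g n = 1] (mod int p ^ n)"
    | "p = 2" "\<And>n. [unit g n = - 1] (mod int p ^ n)"
    using padic_prime_power_root_of_unity[OF prime, of "unit g" k] by blast
  then show ?thesis
  proof cases
    case 1
    have "h (g \<otimes> x \<otimes> inv g) n = h x n" if "x \<in> N" for x n
      using cong_mult[OF 1[of n] cong_refl[of "h x n"]] N.coord_mod[OF that, of n n]
      by (simp add: coord_conj[OF g that] cong_def)
    then show ?thesis
      using mem_C_iff_conj[OF g] N.coord_eqI[OF g_N] by blast
  next
    case 2
    have "h (g \<otimes> x \<otimes> inv g) n = h (inv x) n" if "x \<in> N" for x n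
      using cong_mult[OF 2(2)[of n] cong_refl[of "h x n"]]
      by (simp add: coord_conj[OF g that] N.coord_inv[OF that] cong_def)
    then show ?thesis
      using 2(1) N.coord_eqI[OF g_N N.closed(2)] by blast
  qed
qed

text \<open>The q-th power map with q = p^k embeds the torsion-free abelian group \<open>C\<close>
  into \<open>N\<close>. In coordinates its image consists of all multiples of some p^s, so dividing
  by p^s yields the isomorphism. Neighbourhoods in \<open>C\<close> and \<open>N\<close> are
  compared through the same power map.\<close>

lemma C_padic:
  obtains \<phi> where "\<phi> \<in> iso (G\<lparr>carrier := C\<rparr>) (padic_int_group p)"
    and "\<And>n. openin T {c \<in> C. \<phi> c n = 0}"
    and "\<And>U. openin T U \<Longrightarrow> \<one> \<in> U \<Longrightarrow> \<exists>n. {c \<in> C. \<phi> c n = 0} \<subseteq> U"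
proof -
  let ?q = "p ^ k"
  define f where "f c = h (c [^] ?q)" for c
  have qN: "c [^] ?q \<in> N" if "c \<in> C" for c using pow_index_mem[OF C_carrier[OF that]] .
  have NC: "x \<in> C" if "x \<in> N" for x using N_subset_C that by blast
  have f_mult: "f (c \<otimes> e) n = (f c n + f e n) mod int p ^ n" if "c \<in> C" "e \<in> C" for c e n
    using that by (simp add: f_def C_pow_mult N.coord_mult qN)
  have f_inj: "c = e" if "c \<in> C" "e \<in> C" "\<And>n. f c n = f e n" for c e
    using C_pow_inj[OF that(1,2) _ index_pos] N.coord_eqI[OF qN[OF that(1)] qN[OF that(2)]] that(3)
    by (simp add: f_def)
  have f_one: "f \<one> n = 0" for n by (simp add: f_def N.coord_one)
  have f_padic: "f c \<in> carrier (padic_int_group p)" if "c \<in> C" for c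
    using N.coord_padic[OF qN[OF that]] by (simp add: f_def)
  note f_mod = padic_int_mod[OF f_padic]
  have "h generator 1 \<noteq> h \<one> 1"
    using prime_gt_1_nat[OF prime] by (simp add: generator N.coord_one)
  then have "generator \<noteq> \<one>" by auto
  then obtain n where "f generator n \<noteq> 0"
    using f_inj[OF NC[OF generator(1)] C_closed(1)] f_one by metis
  then have ex: "\<exists>n. \<exists>c\<in>C. f c n \<noteq> 0" using NC generator(1) by blast
  \<comment> \<open>\<open>m\<close> is the first level at which \<open>f\<close> is not identically
    zero; the minimal valuation in the image of \<open>f\<close> is then s = m - 1.\<close>
  define m where "m = (LEAST n. \<exists>c\<in>C. f c n \<noteq> 0)"
  obtain c0 where c0: "c0 \<in> C" "f c0 m \<noteq> 0"
    using LeastI_ex[OF ex] unfolding m_def by blast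
  have least: "f c n = 0" if "c \<in> C" "n < m" for c n
    using not_less_Least that unfolding m_def by blast
  have "f c0 0 = 0" using padic_int_bounds[OF f_padic[OF c0(1)], of 0] by simp
  then obtain s where s: "m = Suc s" using c0(2) by (cases m) auto
  have fs: "f c s = 0" if "c \<in> C" for c using least[OF that] s by simp
  define \<phi> where "\<phi> c n = f c (s + n) div int p ^ s" for c n
  have p0: "p > 0" using prime prime_gt_0_nat by blast
  have \<phi>_padic: "\<phi> c \<in> carrier (padic_int_group p)" if "c \<in> C" for c
    using padic_int_shift(2)[OF f_padic[OF that] fs[OF that] p0] by (simp add: \<phi>_def[abs_def])
  have \<phi>: "int p ^ s * \<phi> c n = f c (s + n)" if "c \<in> C" for c n
    using padic_int_shift(1)[OF f_padic[OF that] fs[OF that] p0] by (simp add: \<phi>_def)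
  have ps: "int p ^ s \<noteq> 0" using p0 by simp
  have \<phi>_mult: "\<phi> (c \<otimes> e) n = (\<phi> c n + \<phi> e n) mod int p ^ n" if "c \<in> C" "e \<in> C" for c e n
  proof -
    have "int p ^ s * \<phi> (c \<otimes> e) n = (int p ^ s * (\<phi> c n + \<phi> e n)) mod (int p ^ s * int p ^ n)"
      using that by (simp add: \<phi> C_closed f_mult distrib_left power_add)
    then show ?thesis using p0 by (simp add: mult_mod_right[symmetric] del: mod_mult_mult1)
  qed
  have \<phi>_inj: "c = e" if "c \<in> C" "e \<in> C" "\<phi> c = \<phi> e" for c e
  proof (rule f_inj[OF that(1,2)])
    fix n
    have "f c (s + n) = f e (s + n)" using \<phi>[OF that(1), of n] \<phi>[OF that(2), of n] that(3) by simp
    then show "f c n = f e n"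
      using f_mod[OF that(1), of n "s + n"] f_mod[OF that(2), of n "s + n"] by simp
  qed
  have \<phi>_surj: "\<exists>c\<in>C. \<phi> c = z" if z: "z \<in> carrier (padic_int_group p)" for z
  proof -
    obtain y where y: "y \<in> N" "h y = z" using N.coord_surj[OF z] .
    define x where "x = y [^] (p ^ s)"
    have x: "x \<in> N" using y(1) by (simp add: x_def N.pow_closed)
    have hx: "h x n = int p ^ s * z n mod int p ^ n" for n
      using N.coord_pow[OF y(1), of "p ^ s"] y(2) by (simp add: x_def)
    \<comment> \<open>\<open>Suc s\<close> levels show that \<open>f c0\<close> has valuation
      exactly \<open>s\<close>. The additional \<open>k\<close> levels make the error of
      approximating \<open>x\<close> by a power of c0^q divisible by p^k, hence a q-th power in
      \<open>N\<close>.\<close>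
    define M where "M = Suc s + k"
    have "f c0 M mod int p ^ s = 0" "f c0 M mod int p ^ Suc s \<noteq> 0" "h x M mod int p ^ s = 0"
      using f_mod[OF c0(1), of s M] f_mod[OF c0(1), of "Suc s" M] N.coord_mod[OF x, of s M]
        fs[OF c0(1)] c0(2) s hx[of s] by (simp_all add: M_def del: power_Suc)
    from exists_multiple_mod_prime_power[OF prime this, of M]
    obtain i :: nat where i: "int i * f c0 M mod int p ^ M = h x M mod int p ^ M" by blast
    define r where "r = (c0 [^] i) [^] ?q"
    have r: "r \<in> N" using C_pow_closed[OF c0(1)] qN by (simp add: r_def)
    have "r = (c0 [^] ?q) [^] i" using C_carrier[OF c0(1)] by (simp add: r_def nat_pow_pow mult.commute)
    then have "h r M = h x M"
      using N.coord_pow[OF qN[OF c0(1)], of i M] i N.coord_mod[OF x, of M M] by (simp add: f_def)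
    then have "h (inv r \<otimes> x) M = 0"
      using N.coord_mult[OF N.closed(2)[OF r] x] N.coord_inv[OF r] by (simp add: mod_simps)
    then have "h (inv r \<otimes> x) k = 0"
      using N.coord_mod[OF N.closed(3)[OF N.closed(2)[OF r] x], of k M] by (simp add: M_def)
    then obtain w where w: "w \<in> N" "w [^] ?q = inv r \<otimes> x"
      using N.exists_root[OF N.closed(3)[OF N.closed(2)[OF r] x]] by blast
    define c where "c = c0 [^] i \<otimes> w"
    have c: "c \<in> C" using C_pow_closed[OF c0(1)] NC[OF w(1)] by (simp add: c_def C_closed)
    have "c [^] ?q = r \<otimes> (inv r \<otimes> x)"
      using C_pow_mult[OF C_pow_closed[OF c0(1)] NC[OF w(1)]] w(2) by (simp add: c_def r_def)
    also have "\<dots> = x" using N.mem_carrier[OF r] N.mem_carrier[OF x] by (simp flip: m_assoc)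
    finally have "f c n = h x n" for n by (simp add: f_def)
    then have "int p ^ s * \<phi> c n = int p ^ s * z n" for n
      using hx[of "s + n"] padic_int_mod[OF z, of n "s + n"]
      by (simp add: \<phi>[OF c] power_add)
    then have "\<phi> c = z" using ps by auto
    with c show ?thesis by blast
  qed
  show ?thesis
  proof
    show "\<phi> \<in> iso (G\<lparr>carrier := C\<rparr>) (padic_int_group p)"
    proof (rule isoI)
      show "\<phi> \<in> hom (G\<lparr>carrier := C\<rparr>) (padic_int_group p)"
        using \<phi>_padic \<phi>_mult by (auto simp: hom_def padic_int_group_def)
      show "bij_betw \<phi> (carrier (G\<lparr>carrier := C\<rparr>)) (carrier (padic_int_group p))"
        using \<phi>_inj \<phi>_surj \<phi>_padic by (auto simp: bij_betw_def inj_on_def image_iff) metis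
    qed
    have \<phi>_0_iff: "\<phi> c n = 0 \<longleftrightarrow> f c (s + n) = 0" if "c \<in> C" for c n
      using \<phi>[OF that, of n] ps by auto
    show "openin T {c \<in> C. \<phi> c n = 0}" for n
    proof (rule open_subgroup_if_contains_open)
      have "f (inv c) (s + n) = 0" if "c \<in> C" "f c (s + n) = 0" for c
        using f_mult[OF C_closed(2)[OF that(1)] that(1), of "s + n"] that f_one
          f_mod[OF C_closed(2)[OF that(1)], of "s + n" "s + n"] by (simp add: C_carrier)
      then show "subgroup {c \<in> C. \<phi> c n = 0} G"
        by (intro subgroupI) (auto simp: C_carrier C_closed \<phi>_0_iff f_mult f_one intro!: exI[of _ "\<one>"])
      show "openin T {x \<in> N. h x (s + n) = 0}" by (rule N_congruence_open)
      show "\<one> \<in> {x \<in> N. h x (s + n) = 0}" by (simp add: N.closed N.coord_one)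
      show "{x \<in> N. h x (s + n) = 0} \<subseteq> {c \<in> C. \<phi> c n = 0}"
        by (auto simp: NC \<phi>_0_iff f_def N.coord_pow)
    qed
    fix U assume U: "openin T U" "\<one> \<in> U"
    then obtain j where j: "{x \<in> N. h x j = 0} \<subseteq> U" using N_congruence_base by blast
    \<comment> \<open>A zero residue at level j + k makes c^q a p^(j+k)-th power of some y in
      \<open>N\<close>; uniqueness of q-th roots in \<open>C\<close> gives c = y^(p^j), so c lies in
      \<open>N\<close> with zero residue at level \<open>j\<close>.\<close>
    have "c \<in> U" if c: "c \<in> C" and "\<phi> c (j + k) = 0" for c
    proof -
      have "f c (s + (j + k)) = 0" using that \<phi>_0_iff by simp
      then have "f c (j + k) = 0" using f_mod[OF c, of "j + k" "s + (j + k)"] by simp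
      then obtain y where y: "y \<in> N" "y [^] (p ^ (j + k)) = c [^] ?q"
        using N.exists_root[OF qN[OF c], of "j + k"] by (auto simp: f_def)
      then have "(y [^] (p ^ j)) [^] ?q = c [^] ?q"
        by (simp add: nat_pow_pow N.mem_carrier power_add)
      then have "y [^] (p ^ j) = c"
        using C_pow_inj[OF C_pow_closed[OF NC[OF y(1)]] c _ index_pos] by blast
      then have "c \<in> N" "h c j = 0" using y(1) N.pow_closed N.coord_pow[OF y(1), of "p ^ j" j] by auto
      then show ?thesis using j by blast
    qed
    then show "\<exists>n. {c \<in> C. \<phi> c n = 0} \<subseteq> U" by blast
  qed
qed

lemma comm_group_if_C_eq:
  assumes "C = carrier G"
  shows "comm_group G"
  by (rule group_comm_groupI) (use C_commutes assms in auto)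

theorem pro_2_dihedral:
  assumes "\<not> comm_group G"
  obtains \<phi> t where "pro_2_dihedral_group G T C \<phi> t"
proof -
  obtain t where t: "t \<in> carrier G" "t \<notin> C"
    using comm_group_if_C_eq assms C_carrier by blast
  then have p: "p = 2" and inverts_N: "\<And>g x. g \<in> carrier G \<Longrightarrow> g \<notin> C \<Longrightarrow> x \<in> N \<Longrightarrow> g \<otimes> x \<otimes> inv g = inv x"
    using conj_trivial_or_inverts by blast+
  \<comment> \<open>Each of the two factors inverts \<open>N\<close>, so their product centralizes
    it; this gives index 2.\<close>
  have mult: "g \<otimes> g' \<in> C" if g: "g \<in> carrier G" "g \<notin> C" "g' \<in> carrier G" "g' \<notin> C" for g g'
    unfolding mem_C_iff_conj[OF m_closed[OF g(1,3)]]
    using inverts_N[OF g(1,2)] inverts_N[OF g(3,4)] g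
    by (simp add: conj_comp N.mem_carrier N.closed)
  \<comment> \<open>The p^k-th power of \<open>c\<close> lies in \<open>N\<close> and is inverted by
    \<open>t\<close>, and p^k-th roots in \<open>C\<close> are unique.\<close>
  have inverts: "t \<otimes> c \<otimes> inv t = inv c" if c: "c \<in> C" for c
  proof (rule C_pow_inj[OF _ C_closed(2)[OF c] _ index_pos])
    show "t \<otimes> c \<otimes> inv t \<in> C" using normal.inv_op_closed2[OF C_normal t(1) c] .
    show "(t \<otimes> c \<otimes> inv t) [^] (p ^ k) = inv c [^] (p ^ k)"
      using conj_pow[OF t(1) C_carrier[OF c]] inverts_N[OF t pow_index_mem[OF C_carrier[OF c]]]
      by (simp add: nat_pow_inv C_carrier c)
  qed
  \<comment> \<open>The square of \<open>t\<close> lies in \<open>C\<close>, so \<open>t\<close>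
    inverts it, but \<open>t\<close> also commutes with it. Hence t^4 = 1, and \<open>C\<close> has
    no torsion.\<close>
  have tt: "t \<otimes> t \<in> C" using mult[OF t t] .
  have "inv (t \<otimes> t) = t \<otimes> t"
    using inverts[OF tt] t(1) by (simp add: m_assoc)
  then have "(t \<otimes> t) [^] (2::nat) = \<one>"
    using t(1) r_inv[of "t \<otimes> t"] by (simp add: numeral_2_eq_2)
  then have square: "t \<otimes> t = \<one>" using C_torsion_free[OF tt] by simp
  obtain \<phi> where \<phi>: "\<phi> \<in> iso (G\<lparr>carrier := C\<rparr>) (padic_int_group p)"
    "\<And>n. openin T {c \<in> C. \<phi> c n = 0}"
    "\<And>U. openin T U \<Longrightarrow> \<one> \<in> U \<Longrightarrow> \<exists>n. {c \<in> C. \<phi> c n = 0} \<subseteq> U"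
    by (rule C_padic) blast
  have "t \<otimes> c = inv c \<otimes> t" if "c \<in> C" for c
    using inverts[OF that] t(1) C_carrier[OF that] inv_solve_right'[of "inv c" "t \<otimes> c" t] by simp
  then have "pro_2_dihedral_group G T C \<phi> t"
    by (intro pro_2_dihedral_group.intro pro_2_dihedral_group_axioms.intro
        topological_group_axioms C_normal \<phi>[unfolded p] mult t square)
  then show ?thesis by (rule that)
qed

end

theorem corollary4p16:
  fixes p :: nat and G :: "('a, 'b) monoid_scheme" and T :: "'a topology"
  assumes "prime p"
    and "pro_p_group G T p"
    and "just_infinite_group G T"
    and "\<not> comm_group G"
    and "virtually_padic_int p G T"
  shows "subgroup_topology G T homeomorphic_space (pelczynski_space \<oplus>\<^sub>t\<^sub>o\<^sub>p omega_plus_one)"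
proof -
  interpret pro_p_group G T p by fact
  interpret just_infinite_group G T by fact
  obtain N h where N: "N \<lhd> G" "openin T N" "h \<in> iso (G\<lparr>carrier := N\<rparr>) (padic_int_group p)"
    "homeomorphic_map (subtopology T N) (padic_int_topology p) h"
    using assms(5) by (auto simp: virtually_padic_int_def)
  obtain k where k: "order (G Mod N) = p ^ k" using order_quotient[OF N(1,2)] by blast
  \<comment> \<open>A finite subgroup is closed in a Hausdorff space, so a non-trivial normal one
    would be open. Its index is a power of p, thus a positive \<open>card\<close> and so finite, and
    \<open>G\<close> would be finite.\<close>
  have no_finite: "K = {\<one>\<^bsub>G\<^esub>}" if K: "K \<lhd> G" "finite K" for K
  proof (rule ccontr)
    assume "K \<noteq> {\<one>\<^bsub>G\<^esub>}"
    have sub: "subgroup K G" using K(1) by (rule normal_imp_subgroup)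
    then have Kc: "K \<subseteq> carrier G" by (rule subgroup.subset)
    then have "closedin T K"
      using closedin_Hausdorff_finite[OF Hausdorff, of K] K(2) by (simp add: topspace_eq)
    then have "openin T K" using open_normal K(1) \<open>K \<noteq> {\<one>\<^bsub>G\<^esub>}\<close> by blast
    then obtain j where "order (G Mod K) = p ^ j" using order_quotient K(1) by blast
    then have "card (rcosets\<^bsub>G\<^esub> K) > 0"
      using prime_gt_0_nat[OF assms(1)] by (simp add: order_def FactGroup_def)
    then have "finite (rcosets\<^bsub>G\<^esub> K)" by (rule card_ge_0_finite)
    moreover have "finite X" if "X \<in> rcosets\<^bsub>G\<^esub> K" for X
      using that K(2) by (auto simp: RCOSETS_def r_coset_def)
    ultimately have "finite (\<Union>(rcosets\<^bsub>G\<^esub> K))" by blast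
    then show False using rcosets_part_G[OF sub] infinite_carrier by simp
  qed
  interpret padic_extension G T N h p k
    by (intro padic_extension.intro padic_extension_axioms.intro topological_group_axioms
        N assms(1) k no_finite)
  obtain \<phi> t where "pro_2_dihedral_group G T C \<phi> t" using pro_2_dihedral[OF assms(4)] .
  then show ?thesis by (rule pro_2_dihedral_group.subgroup_topology_homeomorphic)
qed

end
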